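(* Let $(R,\mathfrak{m})$ be a local ring with infinite residue field and $\operatorname{depth} R>0$. For every ideal $I$ of $R$, we have $$n_2(I)\leq n_3(I)=n_1(I).$$
   Context: All rings are commutative, Noetherian and unital; a local ring is such a ring with a unique maximal ideal $\mathfrak{m}$. For ideals $A,B$ and an element $x$ of $R$, $A:B=\{r\in R\mid rB\subseteq A\}$ and $A:x=A:(x)$. Convention: $\mathfrak{m}^0=R$. Let $(R,\mathfrak{m})$ be a local ring with infinite residue field and let $J$ be an ideal of $R$. - $J$ is $\mathfrak{m}$-full if $J\mathfrak{m}:x=J$ for some element $x\in\mathfrak{m}\setminus\mathfrak{m}^2$. - $J$ is full if $J:x=J:\mathfrak{m}$ for some element $x\in\mathfrak{m}\setminus\mathfrak{m}^2$. - $J$ is weakly $\mathfrak{m}$-full if $J\mathfrak{m}:\mathfrak{m}=J$. If moreover $\operatorname{depth} R>0$ (i.e. $\mathfrak{m}$ contains a non-zero-divisor of $R$), then for an ideal $I$ of $R$ set - $n_1(I)=\min\{t\geq 0\mid I\mathfrak{m}^n \text{ is } \mathfrak{m}\text{-full for all } n\geq t\}$; - $n_2(I)=\min\{t\geq 0\mid I\mathfrak{m}^n \text{ is full for all } n\geq t\}$; - $n_3(I)=\min\{t\geq 0\mid I\mathfrak{m}^n \text{ is weakly } \mathfrak{m}\text{-full for all } n\geq t\}$. It is known (H. Dao) that these minima exist. *)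

theory Defs
  imports "HOL-Algebra.Algebra"
begin

locale noetherian_local_ring = noetherian_ring R + cring R
  for R :: "('a, 'b) ring_scheme" (structure) and \<mm> :: "'a set" +
  assumes unique_maximalideal: "maximalideal M R \<longleftrightarrow> M = \<mm>"

text \<open>Powers are taken in the monoid of ideals under the ideal product, whose unit is the
  whole ring; so \<open>ideal_pow R A 0 = carrier R\<close>.\<close>

abbreviation ideal_pow :: "('a, 'b) ring_scheme \<Rightarrow> 'a set \<Rightarrow> nat \<Rightarrow> 'a set"
  where "ideal_pow R A n \<equiv> A [^]\<^bsub>ideals_set R\<^esub> n"

definition ideal_colon :: "('a, 'b) ring_scheme \<Rightarrow> 'a set \<Rightarrow> 'a set \<Rightarrow> 'a set"
  where "ideal_colon R A B = {r \<in> carrier R. \<forall>b\<in>B. r \<otimes>\<^bsub>R\<^esub> b \<in> A}"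

definition elem_colon :: "('a, 'b) ring_scheme \<Rightarrow> 'a set \<Rightarrow> 'a \<Rightarrow> 'a set"
  where "elem_colon R A x = ideal_colon R A (PIdl\<^bsub>R\<^esub> x)"

definition nonzerodivisor :: "('a, 'b) ring_scheme \<Rightarrow> 'a \<Rightarrow> bool"
  where "nonzerodivisor R x \<longleftrightarrow>
    x \<in> carrier R \<and> (\<forall>y \<in> carrier R. x \<otimes>\<^bsub>R\<^esub> y = \<zero>\<^bsub>R\<^esub> \<longrightarrow> y = \<zero>\<^bsub>R\<^esub>)"

text \<open>A Noetherian local ring has positive depth iff its maximal ideal contains a
  non-zero-divisor; this is taken as the meaning of positive depth.\<close>

definition depth_positive :: "('a, 'b) ring_scheme \<Rightarrow> 'a set \<Rightarrow> bool"
  where "depth_positive R \<mm> \<longleftrightarrow> (\<exists>x\<in>\<mm>. nonzerodivisor R x)"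

definition m_full :: "('a, 'b) ring_scheme \<Rightarrow> 'a set \<Rightarrow> 'a set \<Rightarrow> bool"
  where "m_full R \<mm> J \<longleftrightarrow>
    (\<exists>x \<in> \<mm> - ideal_pow R \<mm> 2. elem_colon R (J \<cdot>\<^bsub>R\<^esub> \<mm>) x = J)"

definition full :: "('a, 'b) ring_scheme \<Rightarrow> 'a set \<Rightarrow> 'a set \<Rightarrow> bool"
  where "full R \<mm> J \<longleftrightarrow>
    (\<exists>x \<in> \<mm> - ideal_pow R \<mm> 2. elem_colon R J x = ideal_colon R J \<mm>)"

definition weakly_m_full :: "('a, 'b) ring_scheme \<Rightarrow> 'a set \<Rightarrow> 'a set \<Rightarrow> bool"
  where "weakly_m_full R \<mm> J \<longleftrightarrow> ideal_colon R (J \<cdot>\<^bsub>R\<^esub> \<mm>) \<mm> = J"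

text \<open>Over a local ring with infinite residue field and positive depth the sets below are
  nonempty for every ideal \<open>I\<close> (H. Dao), so that \<open>LEAST\<close> denotes their minimum.\<close>

definition n\<^sub>1 :: "('a, 'b) ring_scheme \<Rightarrow> 'a set \<Rightarrow> 'a set \<Rightarrow> nat"
  where "n\<^sub>1 R \<mm> I = (LEAST t. \<forall>n\<ge>t. m_full R \<mm> (I \<cdot>\<^bsub>R\<^esub> ideal_pow R \<mm> n))"

definition n\<^sub>2 :: "('a, 'b) ring_scheme \<Rightarrow> 'a set \<Rightarrow> 'a set \<Rightarrow> nat"
  where "n\<^sub>2 R \<mm> I = (LEAST t. \<forall>n\<ge>t. full R \<mm> (I \<cdot>\<^bsub>R\<^esub> ideal_pow R \<mm> n))"

definition n\<^sub>3 :: "('a, 'b) ring_scheme \<Rightarrow> 'a set \<Rightarrow> 'a set \<Rightarrow> nat"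
  where "n\<^sub>3 R \<mm> I = (LEAST t. \<forall>n\<ge>t. weakly_m_full R \<mm> (I \<cdot>\<^bsub>R\<^esub> ideal_pow R \<mm> n))"

end

theory Submission
  imports Defs
begin

text \<open>An \<open>\<mm>\<close>-full ideal is weakly \<open>\<mm>\<close>-full, and full with the same \<open>x\<close>. Conversely, write
  \<open>J\<^sub>n = I\<mm>\<^sup>n\<close>: if \<open>J\<^sub>n\<close> is weakly \<open>\<mm>\<close>-full and \<open>J\<^sub>n\<^sub>+\<^sub>1\<close> is \<open>\<mm>\<close>-full, then the \<open>x\<close> for
  \<open>J\<^sub>n\<^sub>+\<^sub>1\<close> also serves for \<open>J\<^sub>n\<close>, so by descending induction it suffices that \<open>J\<^sub>n\<close> is \<open>\<mm>\<close>-full for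
  all large \<open>n\<close>. A general \<open>x \<in> \<mm>\<close> achieves this. It is a nonzerodivisor, so by Artin--Rees
  \<open>xr \<in> J\<^sub>n\<^sub>+\<^sub>1\<close> forces \<open>r \<in> \<mm>\<^sup>n\<^sup>-\<^sup>c\<close> for a constant \<open>c\<close>; and \<open>xt\<close> is injective in large degrees on the
  finitely generated module \<open>\<Oplus> \<mm>\<^sup>n / J\<^sub>n\<^sub>+\<^sub>1\<close> over the Rees algebra, which moves \<open>r\<close> step by
  step up to \<open>J\<^sub>n\<close>.\<close>

section \<open>Ideals and their powers\<close>

lemma (in ring) ideal_mem:
  assumes "ideal A R"
  shows "A \<subseteq> carrier R" "\<zero> \<in> A"
    "\<And>x y. x \<in> A \<Longrightarrow> y \<in> A \<Longrightarrow> x \<oplus> y \<in> A"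
    "\<And>x y. x \<in> A \<Longrightarrow> y \<in> A \<Longrightarrow> x \<ominus> y \<in> A"
    "\<And>x r. x \<in> A \<Longrightarrow> r \<in> carrier R \<Longrightarrow> r \<otimes> x \<in> A"
    "\<And>x r. x \<in> A \<Longrightarrow> r \<in> carrier R \<Longrightarrow> x \<otimes> r \<in> A"
  using assms ideal.Icarr additive_subgroup.zero_closed[OF ideal.axioms(1)]
    additive_subgroup.a_closed[OF ideal.axioms(1)] ideal.I_l_closed ideal.I_r_closed
  by (auto simp: minus_eq intro!: additive_subgroup.a_closed[OF ideal.axioms(1)]
      additive_subgroup.a_inv_closed[OF ideal.axioms(1)])

lemma (in cring) cring_idealI:
  assumes "A \<subseteq> carrier R" "\<zero> \<in> A"
    and "\<And>x y. x \<in> A \<Longrightarrow> y \<in> A \<Longrightarrow> x \<oplus> y \<in> A"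
    and "\<And>x r. x \<in> A \<Longrightarrow> r \<in> carrier R \<Longrightarrow> r \<otimes> x \<in> A"
  shows "ideal A R"
proof (rule idealI)
  have "\<ominus> x \<in> A" if "x \<in> A" for x
  proof -
    have "\<ominus> x = (\<ominus> \<one>) \<otimes> x"
      using that assms(1) by (simp add: l_minus subset_iff)
    with assms(4)[OF that, of "\<ominus> \<one>"] show ?thesis
      by simp
  qed
  then show "subgroup A (add_monoid R)"
    using assms(1-3) by (intro add.subgroupI) (auto simp: a_inv_def)
  show "x \<otimes> a \<in> A" "a \<otimes> x \<in> A" if "a \<in> A" "x \<in> carrier R" for a x
    using that assms(1) assms(4)[OF that] by (auto simp: m_comm[of a x] subset_iff)
qed (rule ring_axioms)

text \<open>Lets \<open>r u\<close> in \<open>B\<close> extend from generators, or from products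
  spanning an ideal, to every \<open>r\<close> in that ideal.\<close>

lemma (in cring) ideal_multiplier:
  assumes "ideal B R" "u \<in> carrier R"
  shows "ideal {r \<in> carrier R. r \<otimes> u \<in> B} R"
  using assms ideal_mem[OF assms(1)]
  by (intro cring_idealI) (auto simp: l_distr m_assoc)

lemma (in cring) ideal_image_mult:
  assumes "ideal B R" "a \<in> carrier R"
  shows "ideal ((\<lambda>v. a \<otimes> v) ` B) R"
proof (rule cring_idealI)
  note B = ideal_mem[OF assms(1)]
  show "(\<lambda>v. a \<otimes> v) ` B \<subseteq> carrier R"
    using B(1) assms(2) by auto
  show "\<zero> \<in> (\<lambda>v. a \<otimes> v) ` B"
    using B(2) assms(2) by (intro image_eqI[of _ _ \<zero>]) auto
  show "x \<oplus> y \<in> (\<lambda>v. a \<otimes> v) ` B"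
    if xy: "x \<in> (\<lambda>v. a \<otimes> v) ` B" "y \<in> (\<lambda>v. a \<otimes> v) ` B" for x y
  proof -
    obtain u v where "u \<in> B" "x = a \<otimes> u" "v \<in> B" "y = a \<otimes> v"
      using xy by auto
    then show ?thesis
      using B assms(2) by (intro image_eqI[of _ _ "u \<oplus> v"]) (auto simp: r_distr subset_iff)
  qed
  show "r \<otimes> x \<in> (\<lambda>v. a \<otimes> v) ` B" if "x \<in> (\<lambda>v. a \<otimes> v) ` B" "r \<in> carrier R" for x r
  proof -
    obtain u where "u \<in> B" "x = a \<otimes> u"
      using \<open>x \<in> (\<lambda>v. a \<otimes> v) ` B\<close> by auto
    then show ?thesis
      using B assms(2) that by (intro image_eqI[of _ _ "r \<otimes> u"]) (auto simp: m_lcomm subset_iff)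
  qed
qed

lemma (in cring) ideal_prod_subsetI:
  assumes "ideal C R" "\<And>i j. i \<in> A \<Longrightarrow> j \<in> B \<Longrightarrow> i \<otimes> j \<in> C"
  shows "A \<cdot> B \<subseteq> C"
proof
  show "x \<in> C" if "x \<in> A \<cdot> B" for x
    using that by induction (auto simp: assms ideal_mem)
qed

lemma ideal_prod_mono: "A \<subseteq> A' \<Longrightarrow> B \<subseteq> B' \<Longrightarrow> A \<cdot>\<^bsub>R\<^esub> B \<subseteq> A' \<cdot>\<^bsub>R\<^esub> B'"
proof
  fix x assume *: "A \<subseteq> A'" "B \<subseteq> B'" and "x \<in> A \<cdot>\<^bsub>R\<^esub> B"
  from this(3) show "x \<in> A' \<cdot>\<^bsub>R\<^esub> B'"
    by induction (use * in \<open>auto intro: ideal_prod.intros\<close>)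
qed

lemma ideal_pow_0: "ideal_pow R A 0 = carrier R"
  by (simp add: nat_pow_def ideals_set_def)

lemma ideal_pow_Suc: "ideal_pow R A (Suc n) = ideal_pow R A n \<cdot>\<^bsub>R\<^esub> A"
  by (simp add: nat_pow_def ideals_set_def)

context cring
begin

lemma elem_colon_eq:
  assumes B: "ideal B R" and x: "x \<in> carrier R"
  shows "elem_colon R B x = {r \<in> carrier R. r \<otimes> x \<in> B}"
proof (intro equalityI subsetI)
  fix r assume "r \<in> elem_colon R B x"
  then show "r \<in> {r \<in> carrier R. r \<otimes> x \<in> B}"
    using cgenideal_self[OF x] by (simp add: elem_colon_def ideal_colon_def)
next
  fix r assume "r \<in> {r \<in> carrier R. r \<otimes> x \<in> B}"
  then have r: "r \<in> carrier R" "r \<otimes> x \<in> B"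
    by auto
  have "r \<otimes> b \<in> B" if b: "b \<in> PIdl x" for b
  proof -
    obtain s where s: "s \<in> carrier R" "b = s \<otimes> x"
      using b by (auto simp: cgenideal_def)
    then have "r \<otimes> b = s \<otimes> (r \<otimes> x)"
      using r(1) x by (simp add: m_lcomm)
    then show ?thesis
      using ideal_mem(5)[OF B r(2) s(1)] by simp
  qed
  then show "r \<in> elem_colon R B x"
    using r(1) by (simp add: elem_colon_def ideal_colon_def)
qed

lemma ideal_pow_ideal: "ideal A R \<Longrightarrow> ideal (ideal_pow R A n) R"
  by (induction n) (simp_all only: ideal_pow_0 ideal_pow_Suc oneideal ideal_prod_is_ideal)

lemma ideal_pow_1: "ideal A R \<Longrightarrow> ideal_pow R A (Suc 0) = A"
  by (simp only: ideal_pow_0 ideal_pow_Suc ideal_prod_commute[OF oneideal] ideal_prod_one)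

lemma ideal_pow_add:
  assumes "ideal A R"
  shows "ideal_pow R A (k + n) = ideal_pow R A k \<cdot> ideal_pow R A n"
proof (induction n)
  case 0
  then show ?case
    by (simp only: add_0_right ideal_pow_0 ideal_prod_one[OF ideal_pow_ideal[OF assms]])
next
  case (Suc n)
  then show ?case
    by (simp only: add_Suc_right ideal_pow_Suc ideal_prod_assoc ideal_pow_ideal assms)
qed

lemma ideal_pow_mult_mem:
  assumes "ideal A R" "x \<in> ideal_pow R A k" "y \<in> ideal_pow R A n"
  shows "x \<otimes> y \<in> ideal_pow R A (k + n)"
  unfolding ideal_pow_add[OF assms(1)] using assms by (intro ideal_prod.prod)

lemma ideal_pow_anti_mono:
  assumes "ideal A R" "k \<le> n"
  shows "ideal_pow R A n \<subseteq> ideal_pow R A k"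
proof -
  obtain j where "n = k + j"
    using assms(2) le_iff_add by auto
  then show ?thesis
    using ideal_prod_inter[OF ideal_pow_ideal ideal_pow_ideal, OF assms(1) assms(1), of k j]
    by (simp only: ideal_pow_add[OF assms(1)]) blast
qed

lemma ideal_pow_mem_power:
  assumes "ideal A R" "x \<in> A"
  shows "x [^] (n::nat) \<in> ideal_pow R A n"
proof (induction n)
  case 0
  then show ?case
    by (simp only: ideal_pow_0 nat_pow_0 one_closed)
next
  case (Suc n)
  then show ?case
    by (simp only: ideal_pow_Suc nat_pow_Suc ideal_prod.prod assms)
qed

end

section \<open>Graded submodules of the Rees algebra\<close>

text \<open>A graded submodule of \<open>\<Oplus> V\<^sub>n t\<^sup>n\<close>, stable under multiplication by \<open>a t\<close> for \<open>a \<in> S\<close>, is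
  encoded by the sequence of its homogeneous components, which are ideals of \<open>R\<close>. Inclusion
  of submodules is the pointwise order on sequences.\<close>

definition graded_submodule ::
  "('a, 'b) ring_scheme \<Rightarrow> (nat \<Rightarrow> 'a set) \<Rightarrow> 'a set \<Rightarrow> (nat \<Rightarrow> 'a set) \<Rightarrow> bool"
  where "graded_submodule R V S N \<longleftrightarrow>
    (\<forall>n. ideal (N n) R \<and> N n \<subseteq> V n \<and> (\<forall>a\<in>S. \<forall>u\<in>N n. a \<otimes>\<^bsub>R\<^esub> u \<in> N (Suc n)))"

text \<open>Equality \<open>F k = F K\<close> is between whole sequences, so one \<open>K\<close>
  serves all degrees at once.\<close>

definition graded_noetherian ::
  "('a, 'b) ring_scheme \<Rightarrow> (nat \<Rightarrow> 'a set) \<Rightarrow> 'a set \<Rightarrow> bool"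
  where "graded_noetherian R V S \<longleftrightarrow>
    (\<forall>F. mono F \<and> (\<forall>k. graded_submodule R V S (F k)) \<longrightarrow> (\<exists>K::nat. \<forall>k\<ge>K. F k = F K))"

lemma graded_submoduleD:
  assumes "graded_submodule R V S N"
  shows "ideal (N n) R" "N n \<subseteq> V n" "\<And>a u. a \<in> S \<Longrightarrow> u \<in> N n \<Longrightarrow> a \<otimes>\<^bsub>R\<^esub> u \<in> N (Suc n)"
  using assms by (auto simp: graded_submodule_def)

lemma graded_submodule_mono:
  "graded_submodule R V S N \<Longrightarrow> V \<le> V' \<Longrightarrow> S' \<subseteq> S \<Longrightarrow> graded_submodule R V' S' N"
  unfolding graded_submodule_def le_fun_def by blast

lemma graded_noetherianD:
  assumes "graded_noetherian R V S" "mono F" "\<And>k. graded_submodule R V S (F k)"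
  obtains K::nat where "\<And>k. k \<ge> K \<Longrightarrow> F k = F K"
  using assms unfolding graded_noetherian_def by meson

text \<open>A smaller ambient sequence and more operators admit fewer submodules. This permits
  passing from finitely many generators to the whole ideal.\<close>

lemma graded_noetherian_anti_mono:
  "graded_noetherian R V S \<Longrightarrow> V' \<le> V \<Longrightarrow> S \<subseteq> S' \<Longrightarrow> graded_noetherian R V' S'"
  unfolding graded_noetherian_def using graded_submodule_mono by metis

section \<open>Chain conditions and a graded form of Hilbert's basis theorem\<close>

locale noetherian_cring = noetherian_ring R + cring R for R (structure)

sublocale noetherian_local_ring \<subseteq> noetherian_cring ..

lemma (in noetherian_ring) ideal_seq_stationary:
  fixes F :: "nat \<Rightarrow> 'a set"
  assumes "mono F" "\<And>k. ideal (F k) R"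
  obtains K where "\<And>k. k \<ge> K \<Longrightarrow> F k = F K"
proof -
  have "F k \<subseteq> F l \<or> F l \<subseteq> F k" for k l
    using monoD[OF assms(1)] linear[of k l] by blast
  then have "subset.chain {I. ideal I R} (range F)"
    using assms(2) by (force simp: pred_on.chain_def)
  from ideal_chain_is_trivial[OF _ this] obtain K where "\<Union> (range F) = F K"
    by auto
  then have "F k = F K" if "k \<ge> K" for k
    using monoD[OF assms(1) that] by blast
  with that show thesis .
qed

text \<open>Horner form of the sum of the \<open>a^i V (n - i)\<close> over i at most n. For a
  graded algebra \<open>V\<close> this is the algebra generated over it by \<open>a t\<close>, the
  image of the polynomial ring in one variable X under X -> \<open>a t\<close>.\<close>

primrec adjoin_graded ::
  "('a, 'b) ring_scheme \<Rightarrow> 'a \<Rightarrow> (nat \<Rightarrow> 'a set) \<Rightarrow> nat \<Rightarrow> 'a set"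
  where "adjoin_graded R a V 0 = V 0"
  | "adjoin_graded R a V (Suc n) =
      V (Suc n) <+>\<^bsub>R\<^esub> (\<lambda>v. a \<otimes>\<^bsub>R\<^esub> v) ` adjoin_graded R a V n"

text \<open>With this shift, for \<open>W = adjoin_graded R a V\<close>, each \<open>W n\<close> is
  \<open>V n\<close> plus \<open>a\<close> times \<open>shift_graded R W n\<close>, in degree 0 as
  well.\<close>

definition shift_graded ::
  "('a, 'b) ring_scheme \<Rightarrow> (nat \<Rightarrow> 'a set) \<Rightarrow> nat \<Rightarrow> 'a set"
  where "shift_graded R W n = (case n of 0 \<Rightarrow> {\<zero>\<^bsub>R\<^esub>} | Suc k \<Rightarrow> W k)"

text \<open>The coefficients of the terms of lowest degree \<open>i\<close> in the new variable of the elements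
  of \<open>N\<close>.\<close>

definition lowest_coeffs ::
  "('a, 'b) ring_scheme \<Rightarrow> 'a \<Rightarrow> (nat \<Rightarrow> 'a set) \<Rightarrow> nat \<Rightarrow> (nat \<Rightarrow> 'a set) \<Rightarrow> nat \<Rightarrow> 'a set"
  where "lowest_coeffs R a V i N n =
    {v \<in> V n. \<exists>w \<in> shift_graded R (adjoin_graded R a V) n.
      a [^]\<^bsub>R\<^esub> i \<otimes>\<^bsub>R\<^esub> (v \<oplus>\<^bsub>R\<^esub> a \<otimes>\<^bsub>R\<^esub> w) \<in> N (n + i)}"

lemma (in ring) set_add_memI: "x \<in> A \<Longrightarrow> y \<in> B \<Longrightarrow> x \<oplus> y \<in> A <+>\<^bsub>R\<^esub> B"
  by (auto simp: set_add_def')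

lemma (in ring) set_add_memE:
  assumes "z \<in> A <+>\<^bsub>R\<^esub> B"
  obtains x y where "x \<in> A" "y \<in> B" "z = x \<oplus> y"
  using assms by (auto simp: set_add_def')

context cring
begin

context
  fixes V S a
  assumes V: "graded_submodule R V S V" and a: "a \<in> carrier R" and S: "S \<subseteq> carrier R"
begin

private abbreviation "W \<equiv> adjoin_graded R a V"

lemma adjoin_graded_ideal: "ideal (W n) R"
  by (induction n)
    (auto intro!: add_ideals ideal_image_mult graded_submoduleD(1)[OF V] a)

lemma adjoin_graded_superset: "V \<le> W"
proof (rule le_funI)
  show "V n \<subseteq> W n" for n
  proof (cases n)
    case (Suc k)
    have "v \<in> W n" if "v \<in> V n" for v
    proof -
      have "v \<oplus> a \<otimes> \<zero> \<in> W n"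
        using that Suc ideal_mem(2)[OF adjoin_graded_ideal] by (auto intro!: set_add_memI)
      then show ?thesis
        using that ideal_mem(1)[OF graded_submoduleD(1)[OF V]] a by (auto simp: subset_iff)
    qed
    then show ?thesis ..
  qed simp
qed

lemma adjoin_graded_new: "w \<in> W n \<Longrightarrow> a \<otimes> w \<in> W (Suc n)"
proof -
  assume "w \<in> W n"
  then have "\<zero> \<oplus> a \<otimes> w \<in> W (Suc n)" "w \<in> carrier R"
    using ideal_mem(2)[OF graded_submoduleD(1)[OF V]] ideal_mem(1)[OF adjoin_graded_ideal]
    by (auto intro!: set_add_memI)
  then show ?thesis
    using a by simp
qed

lemma adjoin_graded_old: "b \<in> S \<Longrightarrow> w \<in> W n \<Longrightarrow> b \<otimes> w \<in> W (Suc n)"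
proof (induction n arbitrary: w)
  case 0
  then have "b \<otimes> w \<in> V (Suc 0)"
    using graded_submoduleD(3)[OF V] by simp
  then show ?case
    using le_funD[OF adjoin_graded_superset] by blast
next
  case (Suc n)
  obtain v u where vu: "v \<in> V (Suc n)" "u \<in> W n" "w = v \<oplus> a \<otimes> u"
    using Suc.prems(2) by (auto elim!: set_add_memE)
  then have c: "v \<in> carrier R" "u \<in> carrier R" "b \<in> carrier R"
    using ideal_mem(1)[OF graded_submoduleD(1)[OF V]] ideal_mem(1)[OF adjoin_graded_ideal]
      Suc.prems(1) S by blast+
  then have "b \<otimes> w = b \<otimes> v \<oplus> a \<otimes> (b \<otimes> u)"
    using vu(3) a by (simp add: r_distr m_lcomm)
  moreover have "b \<otimes> v \<in> V (Suc (Suc n))"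
    using graded_submoduleD(3)[OF V] vu Suc.prems by blast
  moreover have "b \<otimes> u \<in> W (Suc n)"
    using Suc.IH Suc.prems(1) vu(2) by blast
  ultimately show ?case
    unfolding adjoin_graded.simps(2)[of R a V "Suc n"] by (auto intro!: set_add_memI)
qed

lemma adjoin_graded_submodule: "graded_submodule R W (insert a S) W"
  using adjoin_graded_ideal adjoin_graded_new adjoin_graded_old
  by (auto simp: graded_submodule_def)

lemma shift_graded_adjoin:
  shows shift_graded_ideal: "ideal (shift_graded R W n) R"
    and shift_graded_old: "b \<in> S \<Longrightarrow> w \<in> shift_graded R W n \<Longrightarrow> b \<otimes> w \<in> shift_graded R W (Suc n)"
proof -
  show "ideal (shift_graded R W n) R"
    by (auto simp: shift_graded_def zeroideal adjoin_graded_ideal split: nat.split)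
  assume *: "b \<in> S" "w \<in> shift_graded R W n"
  then show "b \<otimes> w \<in> shift_graded R W (Suc n)"
  proof (cases n)
    case 0
    then have "b \<otimes> w = \<zero>"
      using * S by (auto simp: shift_graded_def)
    then show ?thesis
      using ideal_mem(2)[OF adjoin_graded_ideal[of n]] by (simp add: shift_graded_def)
  next
    case (Suc k)
    then show ?thesis
      using * adjoin_graded_old[of b w k] by (simp add: shift_graded_def)
  qed
qed

lemma lowest_coeffs_submodule:
  assumes N: "graded_submodule R W (insert a S) N"
  shows "graded_submodule R V S (lowest_coeffs R a V i N)"
  unfolding graded_submodule_def
proof (intro allI conjI ballI)
  fix n
  note N' = ideal_mem[OF graded_submoduleD(1)[OF N]]
    and V' = ideal_mem[OF graded_submoduleD(1)[OF V]] and T' = ideal_mem[OF shift_graded_ideal]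
  have ai: "a [^] i \<in> carrier R"
    using a by simp
  show "lowest_coeffs R a V i N n \<subseteq> V n"
    by (auto simp: lowest_coeffs_def)
  show "ideal (lowest_coeffs R a V i N n) R"
  proof (rule cring_idealI)
    show "lowest_coeffs R a V i N n \<subseteq> carrier R"
      using V'(1) by (auto simp: lowest_coeffs_def)
    show "\<zero> \<in> lowest_coeffs R a V i N n"
      using V'(2) T'(2) N'(2) a by (auto simp: lowest_coeffs_def intro!: bexI[of _ \<zero>])
  next
    fix x y assume "x \<in> lowest_coeffs R a V i N n" "y \<in> lowest_coeffs R a V i N n"
    then obtain u v where uv: "x \<in> V n" "y \<in> V n"
      "u \<in> shift_graded R W n" "v \<in> shift_graded R W n"
      "a [^] i \<otimes> (x \<oplus> a \<otimes> u) \<in> N (n + i)" "a [^] i \<otimes> (y \<oplus> a \<otimes> v) \<in> N (n + i)"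
      by (auto simp: lowest_coeffs_def)
    then have c: "x \<in> carrier R" "y \<in> carrier R" "u \<in> carrier R" "v \<in> carrier R"
      using V'(1) T'(1) by blast+
    have "a [^] i \<otimes> ((x \<oplus> y) \<oplus> a \<otimes> (u \<oplus> v))
        = a [^] i \<otimes> (x \<oplus> a \<otimes> u) \<oplus> a [^] i \<otimes> (y \<oplus> a \<otimes> v)"
      using c a ai by algebra
    also have "\<dots> \<in> N (n + i)"
      using uv N'(3) by blast
    finally show "x \<oplus> y \<in> lowest_coeffs R a V i N n"
      using uv V'(3) T'(3) by (auto simp: lowest_coeffs_def)
  next
    fix x r assume "x \<in> lowest_coeffs R a V i N n" and r: "r \<in> carrier R"
    then obtain u where u: "x \<in> V n" "u \<in> shift_graded R W n"
      "a [^] i \<otimes> (x \<oplus> a \<otimes> u) \<in> N (n + i)"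
      by (auto simp: lowest_coeffs_def)
    then have c: "x \<in> carrier R" "u \<in> carrier R"
      using V'(1) T'(1) by blast+
    have "a [^] i \<otimes> (r \<otimes> x \<oplus> a \<otimes> (r \<otimes> u)) = r \<otimes> (a [^] i \<otimes> (x \<oplus> a \<otimes> u))"
      using c a ai r by algebra
    also have "\<dots> \<in> N (n + i)"
      using u N'(5) r by blast
    finally show "r \<otimes> x \<in> lowest_coeffs R a V i N n"
      using u V'(5) T'(5) r by (auto simp: lowest_coeffs_def)
  qed
  fix b x assume b: "b \<in> S" and "x \<in> lowest_coeffs R a V i N n"
  then obtain u where u: "x \<in> V n" "u \<in> shift_graded R W n"
    "a [^] i \<otimes> (x \<oplus> a \<otimes> u) \<in> N (n + i)"
    by (auto simp: lowest_coeffs_def)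
  then have c: "x \<in> carrier R" "u \<in> carrier R" "b \<in> carrier R"
    using V'(1) T'(1) b S by blast+
  have "a [^] i \<otimes> (b \<otimes> x \<oplus> a \<otimes> (b \<otimes> u)) = b \<otimes> (a [^] i \<otimes> (x \<oplus> a \<otimes> u))"
    using c a ai by algebra
  also have "\<dots> \<in> N (Suc n + i)"
    using graded_submoduleD(3)[OF N, of b] u(3) b by simp
  finally show "b \<otimes> x \<in> lowest_coeffs R a V i N (Suc n)"
    using u graded_submoduleD(3)[OF V] shift_graded_old b by (auto simp: lowest_coeffs_def)
qed

text \<open>Multiplication by \<open>a t\<close> turns a lowest term of degree \<open>i\<close> into
  one of degree \<open>i + 1\<close> with the same coefficient.\<close>

lemma lowest_coeffs_Suc:
  assumes N: "graded_submodule R W (insert a S) N"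
  shows "lowest_coeffs R a V i N \<le> lowest_coeffs R a V (Suc i) N"
proof (rule le_funI, rule subsetI)
  fix n x assume "x \<in> lowest_coeffs R a V i N n"
  then obtain u where u: "x \<in> V n" "u \<in> shift_graded R W n"
    "a [^] i \<otimes> (x \<oplus> a \<otimes> u) \<in> N (n + i)"
    by (auto simp: lowest_coeffs_def)
  then have c: "x \<in> carrier R" "u \<in> carrier R"
    using ideal_mem(1)[OF graded_submoduleD(1)[OF V]] ideal_mem(1)[OF shift_graded_ideal]
    by blast+
  have "a [^] Suc i \<otimes> (x \<oplus> a \<otimes> u) = a \<otimes> (a [^] i \<otimes> (x \<oplus> a \<otimes> u))"
    using c a by (simp add: m_ac)
  also have "\<dots> \<in> N (n + Suc i)"
    using graded_submoduleD(3)[OF N, of a] u(3) by simp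
  finally show "x \<in> lowest_coeffs R a V (Suc i) N n"
    using u by (auto simp: lowest_coeffs_def)
qed

text \<open>Hilbert's argument: subtracting an element of \<open>N\<close> with the same lowest
  coefficient removes the lowest term of an element of \<open>N'\<close>, and the rest is divisible
  by a higher power of \<open>a\<close>. Expansions in powers of \<open>a\<close> are not unique, so
  the claim treats every product of \<open>a [^] i\<close> with an element of
  \<open>W n\<close>.\<close>

lemma lowest_coeffs_determine:
  assumes N: "graded_submodule R W (insert a S) N"
    and N': "graded_submodule R W (insert a S) N'"
    and le: "N \<le> N'"
    and L: "\<And>i. lowest_coeffs R a V i N' \<le> lowest_coeffs R a V i N"
  shows "N' \<le> N"
proof -
  note V' = ideal_mem(1)[OF graded_submoduleD(1)[OF V]] and W' = ideal_mem[OF adjoin_graded_ideal]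
  have "a [^] i \<otimes> y \<in> N (n + i)" if "y \<in> W n" "a [^] i \<otimes> y \<in> N' (n + i)" for n i y
    using that
  proof (induction n arbitrary: i y)
    case 0
    then have y: "y \<in> V 0" "y \<in> carrier R"
      using V' by auto
    then have "y \<in> lowest_coeffs R a V i N' 0"
      using 0 a by (auto simp: lowest_coeffs_def shift_graded_def)
    then have "y \<in> lowest_coeffs R a V i N 0"
      using L by (auto simp: le_fun_def)
    then show ?case
      using a y by (auto simp: lowest_coeffs_def shift_graded_def)
  next
    case (Suc n)
    obtain v w where vw: "v \<in> V (Suc n)" "w \<in> W n" "y = v \<oplus> a \<otimes> w"
      using Suc.prems(1) by (auto elim!: set_add_memE)
    then have "v \<in> lowest_coeffs R a V i N' (Suc n)"
      using Suc.prems(2) by (auto simp: lowest_coeffs_def shift_graded_def)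
    then have "v \<in> lowest_coeffs R a V i N (Suc n)"
      using L by (auto simp: le_fun_def)
    \<comment> \<open>The tail \<open>w'\<close> found for \<open>N\<close> may differ from
      \<open>w\<close>; only the coefficient \<open>v\<close> is shared.\<close>
    then obtain w' where w': "w' \<in> W n" "a [^] i \<otimes> (v \<oplus> a \<otimes> w') \<in> N (Suc n + i)"
      by (auto simp: lowest_coeffs_def shift_graded_def)
    have c: "v \<in> carrier R" "w \<in> carrier R" "w' \<in> carrier R" "a [^] i \<in> carrier R"
      using vw w' V' W'(1) a by auto
    \<comment> \<open>The \<open>v\<close> terms cancel and a factor \<open>a\<close> is gained:
      \<open>n\<close> drops, \<open>i\<close> rises, the total degree stays.\<close>
    have "a [^] Suc i \<otimes> (w \<ominus> w') = a [^] i \<otimes> y \<ominus> a [^] i \<otimes> (v \<oplus> a \<otimes> w')"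
      unfolding vw(3) nat_pow_Suc using c a by algebra
    also have "\<dots> \<in> N' (Suc n + i)"
      using Suc.prems(2) subsetD[OF le_funD[OF le] w'(2)]
      by (rule ideal_mem(4)[OF graded_submoduleD(1)[OF N']])
    finally have "a [^] Suc i \<otimes> (w \<ominus> w') \<in> N (n + Suc i)"
      using Suc.IH[of "w \<ominus> w'" "Suc i"] W'(4) vw(2) w'(1) by simp
    then have "a [^] Suc i \<otimes> (w \<ominus> w') \<oplus> a [^] i \<otimes> (v \<oplus> a \<otimes> w') \<in> N (Suc n + i)"
      using w'(2) ideal_mem(3)[OF graded_submoduleD(1)[OF N]] by simp
    also have "a [^] Suc i \<otimes> (w \<ominus> w') \<oplus> a [^] i \<otimes> (v \<oplus> a \<otimes> w') = a [^] i \<otimes> y"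
      unfolding vw(3) nat_pow_Suc using c a by algebra
    finally show ?case .
  qed
  from this[of _ _ 0] show ?thesis
    using graded_submoduleD(1,2)[OF N'] ideal_mem(1)
    by (auto simp: le_fun_def) (metis l_one subsetD)
qed

text \<open>The two-parameter family \<open>D i k\<close> of lowest coefficients is increasing in both parameters:
  its diagonal becomes stationary, and so do the finitely many rows before that.\<close>

lemma graded_noetherian_adjoin:
  assumes noeth: "graded_noetherian R V S"
  shows "graded_noetherian R W (insert a S)"
  unfolding graded_noetherian_def
proof (intro allI impI, elim conjE)
  fix F :: "nat \<Rightarrow> nat \<Rightarrow> 'a set"
  assume mono: "mono F" and F: "\<forall>k. graded_submodule R W (insert a S) (F k)"
  define D where "D i k = lowest_coeffs R a V i (F k)" for i k
  have D: "graded_submodule R V S (D i k)" for i k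
    unfolding D_def using lowest_coeffs_submodule F by blast
  have D1: "D i k \<le> D j k" if "i \<le> j" for i j k
    using that
  proof (induction rule: dec_induct)
    case (step j)
    show ?case
      using step.IH lowest_coeffs_Suc[OF F[rule_format]] unfolding D_def by (rule order.trans)
  qed simp
  have D2: "D i k \<le> D i l" if "k \<le> l" for i k l
    using le_funD[OF monoD[OF mono that]] by (auto simp: D_def lowest_coeffs_def le_fun_def)
  have D3: "D i k \<le> D j l" if "i \<le> j" "k \<le> l" for i j k l
    using D1[OF that(1)] D2[OF that(2)] by (rule order.trans)
  have "mono (\<lambda>k. D k k)"
    by (intro monoI D3)
  then obtain K where K: "\<And>k. k \<ge> K \<Longrightarrow> D k k = D K K"
    by (rule graded_noetherianD[OF noeth]) (use D in auto)
  have "\<exists>L. \<forall>k\<ge>L. D i k = D i L" for i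
  proof -
    have "mono (D i)"
      by (intro monoI D2)
    then show ?thesis
      by (rule graded_noetherianD[OF noeth]) (use D in auto)
  qed
  then obtain L where L: "\<And>i k. k \<ge> L i \<Longrightarrow> D i k = D i (L i)"
    by metis
  define B where "B = Max (insert K (L ` {..<K}))"
  have B: "K \<le> B" "\<And>i. i < K \<Longrightarrow> L i \<le> B"
    by (auto simp: B_def)
  have "F k = F B" if k: "k \<ge> B" for k
  proof (rule antisym)
    show "F B \<le> F k"
      using monoD[OF mono k] .
    have "D i k \<le> D i B" for i
    proof (cases "i < K")
      case True
      then have "D i k = D i B"
        using B(2)[OF True] k L[of i k] L[of i B] by simp
      then show ?thesis by simp
    next
      case False
      \<comment> \<open>From row \<open>K\<close> on, entries are squeezed between
        \<open>D K K\<close> and the stationary diagonal.\<close>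
      let ?m = "max i k"
      have "D i k \<le> D ?m ?m"
        by (intro D3) auto
      also have "D ?m ?m = D K K"
        using B(1) k by (intro K) auto
      also have "D K K \<le> D i B"
        using False B(1) by (intro D3) auto
      finally show ?thesis .
    qed
    then show "F k \<le> F B"
      using lowest_coeffs_determine[of "F B" "F k"] F monoD[OF mono k] by (simp add: D_def)
  qed
  then show "\<exists>K. \<forall>k\<ge>K. F k = F K"
    by blast
qed

end

end

section \<open>The Noetherian property of the Rees algebra and stability of its graded
  submodules\<close>

context noetherian_cring
begin

text \<open>The generators are adjoined one at a time. Stability under \<open>S\<close> together
  with \<open>V 0 = carrier R\<close> will force \<open>V\<close> to contain the powers of the ideal
  generated by \<open>S\<close>.\<close>

lemma finite_gens_graded_noetherian:
  assumes "finite S" "S \<subseteq> carrier R"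
  shows "\<exists>V. V 0 = carrier R \<and> graded_submodule R V S V \<and> graded_noetherian R V S"
  using assms
proof (induction S rule: finite_induct)
  case empty
  \<comment> \<open>The start is \<open>R\<close> concentrated in degree 0, where the chain
    condition is that of \<open>R\<close> itself.\<close>
  define V where "V n = (if n = 0 then carrier R else {\<zero>})" for n :: nat
  have "graded_submodule R V {} V"
    by (auto simp: graded_submodule_def V_def oneideal zeroideal)
  moreover have "graded_noetherian R V {}"
    unfolding graded_noetherian_def
  proof (intro allI impI, elim conjE)
    fix F :: "nat \<Rightarrow> nat \<Rightarrow> 'a set"
    assume F: "mono F" "\<forall>k. graded_submodule R V {} (F k)"
    have *: "F k (Suc n) = {\<zero>}" for k n
      using graded_submoduleD(2)[OF F(2)[rule_format], of k "Suc n"]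
        ideal_mem(2)[OF graded_submoduleD(1)[OF F(2)[rule_format]], of k "Suc n"]
      by (auto simp: V_def)
    have "mono (\<lambda>k. F k 0)"
      using F(1) by (auto simp: mono_def le_fun_def)
    moreover have "ideal (F k 0) R" for k
      using graded_submoduleD(1)[OF F(2)[rule_format]] .
    ultimately obtain K where K: "\<And>k. k \<ge> K \<Longrightarrow> F k 0 = F K 0"
      by (rule ideal_seq_stationary[of "\<lambda>k. F k 0"]) meson
    have "F k n = F K n" if "k \<ge> K" for k n
      using K[OF that] * by (cases n) simp_all
    then show "\<exists>K. \<forall>k\<ge>K. F k = F K"
      by (intro exI allI impI ext)
  qed
  moreover have "V 0 = carrier R"
    by (simp add: V_def)
  ultimately show ?case
    by blast
next
  case (insert a S)
  then obtain V where V: "V 0 = carrier R" "graded_submodule R V S V" "graded_noetherian R V S"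
    by auto
  then show ?case
    using insert.prems adjoin_graded_submodule[OF V(2)] graded_noetherian_adjoin[OF V(2)]
    by (intro exI[of _ "adjoin_graded R a V"]) auto
qed

text \<open>Stability under finitely many generators extends to \<open>A\<close>, because the
  multipliers carrying a given element into \<open>V (Suc n)\<close> form an ideal. Hence
  \<open>V\<close> contains the powers of \<open>A\<close>, and its chain condition passes to
  them.\<close>

lemma rees_noetherian:
  assumes A: "ideal A R"
  shows "graded_noetherian R (ideal_pow R A) A"
proof -
  obtain S where S: "S \<subseteq> carrier R" "finite S" "A = Idl S"
    using finetely_gen[OF A] by blast
  then obtain V where V: "V 0 = carrier R" "graded_submodule R V S V" "graded_noetherian R V S"
    using finite_gens_graded_noetherian by blast
  note V' = graded_submoduleD(1)[OF V(2)]
  have "ideal_pow R A n \<subseteq> V n" for n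
  proof (induction n)
    case 0
    then show ?case
      by (simp only: ideal_pow_0 V)
  next
    case (Suc n)
    show ?case
      unfolding ideal_pow_Suc
    proof (rule ideal_prod_subsetI[OF V'])
      fix u b assume u: "u \<in> ideal_pow R A n" and b: "b \<in> A"
      then have uV: "u \<in> V n" "u \<in> carrier R"
        using Suc.IH ideal_mem(1)[OF V'] by auto
      have "S \<subseteq> {r \<in> carrier R. r \<otimes> u \<in> V (Suc n)}"
        using S(1) graded_submoduleD(3)[OF V(2)] uV by auto
      then have "A \<subseteq> {r \<in> carrier R. r \<otimes> u \<in> V (Suc n)}"
        unfolding S(3) by (intro genideal_minimal ideal_multiplier V' uV)
      then show "u \<otimes> b \<in> V (Suc n)"
        using b uV m_comm by auto
    qed
  qed
  moreover have "S \<subseteq> A"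
    using genideal_self S by blast
  ultimately show ?thesis
    using graded_noetherian_anti_mono[OF V(3)] by (simp add: le_fun_def)
qed

lemma rees_submodule_pow_mult:
  assumes A: "ideal A R" and N: "graded_submodule R (ideal_pow R A) A N"
    and u: "u \<in> N n" and r: "r \<in> ideal_pow R A j"
  shows "r \<otimes> u \<in> N (n + j)"
proof -
  note N' = graded_submoduleD(1)[OF N]
  have uc: "u \<in> carrier R"
    using u ideal_mem(1)[OF N'] by auto
  have "ideal_pow R A j \<subseteq> {r \<in> carrier R. r \<otimes> u \<in> N (n + j)}"
  proof (induction j)
    case 0
    then show ?case
      using u ideal_mem(5)[OF N' u] by (auto simp only: ideal_pow_0 add_0_right)
  next
    case (Suc j)
    show ?case
      unfolding ideal_pow_Suc
    proof (rule ideal_prod_subsetI[OF ideal_multiplier[OF N' uc]])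
      fix s b assume s: "s \<in> ideal_pow R A j" and b: "b \<in> A"
      then have c: "s \<in> carrier R" "b \<in> carrier R"
        using Suc.IH ideal_mem(1)[OF A] by auto
      have "b \<otimes> (s \<otimes> u) \<in> N (Suc (n + j))"
        using Suc.IH s b by (intro graded_submoduleD(3)[OF N]) auto
      also have "b \<otimes> (s \<otimes> u) = (s \<otimes> b) \<otimes> u"
        using c uc by (simp add: m_ac)
      finally show "s \<otimes> b \<in> {r \<in> carrier R. r \<otimes> u \<in> N (n + Suc j)}"
        using c by simp
    qed
  qed
  then show ?thesis
    using r by auto
qed

text \<open>The submodules generated by the components of degree at most \<open>i\<close> form a stationary
  chain.\<close>

lemma rees_submodule_stable:
  assumes A: "ideal A R" and N: "graded_submodule R (ideal_pow R A) A N"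
  obtains n\<^sub>0 where "\<And>j. N (n\<^sub>0 + j) \<subseteq> ideal_pow R A j \<cdot> N n\<^sub>0"
proof -
  note N' = graded_submoduleD(1)[OF N]
  \<comment> \<open>Above degree \<open>i\<close> a single product suffices: what the lower
    components generate in degree \<open>i\<close> already lies in \<open>N i\<close>.\<close>
  define F where "F i n = (if n \<le> i then N n else ideal_pow R A (n - i) \<cdot> N i)" for i n
  have F1: "F i n \<subseteq> N n" for i n
  proof (cases "n \<le> i")
    case False
    have "ideal_pow R A (n - i) \<cdot> N i \<subseteq> N (i + (n - i))"
      using rees_submodule_pow_mult[OF A N] by (intro ideal_prod_subsetI N')
    then show ?thesis
      using False by (simp add: F_def)
  qed (simp add: F_def)
  have FA: "b \<otimes> u \<in> F i (Suc n)" if b: "b \<in> A" and u: "u \<in> F i n" for i n b u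
  proof (cases "Suc n \<le> i")
    case True
    then show ?thesis
      using b u graded_submoduleD(3)[OF N] by (simp add: F_def)
  next
    case False
    have "u \<in> ideal_pow R A (n - i) \<cdot> N i"
    proof (cases "n = i")
      case True
      have "\<one> \<otimes> u \<in> ideal_pow R A 0 \<cdot> N i"
        using u True unfolding ideal_pow_0 by (intro ideal_prod.prod) (simp_all add: F_def)
      then show ?thesis
        using u True ideal_mem(1)[OF N'] by (auto simp: F_def subset_iff)
    qed (use u False in \<open>auto simp: F_def\<close>)
    then have "b \<otimes> u \<in> A \<cdot> (ideal_pow R A (n - i) \<cdot> N i)"
      using b by (intro ideal_prod.prod)
    also have "\<dots> = ideal_pow R A (Suc (n - i)) \<cdot> N i"
      by (simp only: ideal_pow_Suc ideal_prod_assoc[symmetric] A N' ideal_pow_ideal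
          ideal_prod_commute[of A])
    finally show ?thesis
      using False by (simp add: F_def Suc_diff_le)
  qed
  have gs: "graded_submodule R (ideal_pow R A) A (F i)" for i
    unfolding graded_submodule_def
  proof (intro allI conjI ballI)
    show "ideal (F i n) R" for n
      by (auto simp: F_def intro!: N' ideal_prod_is_ideal ideal_pow_ideal A)
    show "F i n \<subseteq> ideal_pow R A n" for n
      using F1 graded_submoduleD(2)[OF N] by blast
  qed (rule FA)
  have "F i n \<subseteq> F (Suc i) n" for i n
  proof (cases "n \<le> Suc i")
    case True
    then show ?thesis
      using F1[of i n] by (simp add: F_def)
  next
    case False
    then have "n - i = Suc (n - Suc i)"
      by simp
    \<comment> \<open>One factor \<open>A\<close> moves over to \<open>N i\<close>, and
      \<open>A\<close> times \<open>N i\<close> lies in \<open>N (Suc i)\<close>.\<close>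
    then have "F i n = ideal_pow R A (n - Suc i) \<cdot> (A \<cdot> N i)"
      using False ideal_prod_assoc[OF ideal_pow_ideal[OF A] A N']
      by (simp only: F_def ideal_pow_Suc) simp
    also have "\<dots> \<subseteq> ideal_pow R A (n - Suc i) \<cdot> N (Suc i)"
      using graded_submoduleD(3)[OF N] by (intro ideal_prod_mono ideal_prod_subsetI N' order.refl)
    finally show ?thesis
      using False by (simp add: F_def)
  qed
  then have "mono F"
    by (intro iffD2[OF mono_iff_le_Suc] allI le_funI)
  then obtain K where K: "\<And>k. k \<ge> K \<Longrightarrow> F k = F K"
    by (rule graded_noetherianD[OF rees_noetherian[OF A]]) (use gs in auto)
  have "N (K + j) \<subseteq> ideal_pow R A j \<cdot> N K" for j
  proof (cases "j = 0")
    case True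
    then show ?thesis
      using ideal_prod_one[OF N'] by (simp only: ideal_pow_0 add_0_right ideal_prod_commute oneideal N')
  next
    case False
    have "N (K + j) = F (K + j) (K + j)"
      by (simp add: F_def)
    also have "\<dots> = F K (K + j)"
      using K[of "K + j"] by simp
    also have "\<dots> = ideal_pow R A j \<cdot> N K"
      using False by (simp add: F_def)
    finally show ?thesis
      by simp
  qed
  with that show thesis .
qed

section \<open>Artin--Rees for a nonzerodivisor\<close>

lemma nonzerodivisor_cancel:
  assumes "nonzerodivisor R x" "y \<in> carrier R" "z \<in> carrier R" "x \<otimes> y = x \<otimes> z"
  shows "y = z"
proof -
  have "x \<in> carrier R"
    using assms(1) by (simp add: nonzerodivisor_def)
  then have "x \<otimes> (y \<ominus> z) = x \<otimes> y \<ominus> x \<otimes> z"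
    using assms(2,3) by algebra
  also have "\<dots> = \<zero>"
    using assms \<open>x \<in> carrier R\<close> by simp
  finally have "y \<ominus> z = \<zero>"
    using assms(1-3) by (auto simp: nonzerodivisor_def)
  then show ?thesis
    using assms(2,3) r_right_minus_eq by blast
qed

text \<open>Stability of the intersections of \<open>x R\<close> with the powers of \<open>A\<close>
  yields a \<open>c\<close> for which \<open>x R\<close> meets \<open>A^(c + n)\<close> inside
  \<open>A^n\<close> times \<open>x R\<close>, which is \<open>x A^n\<close>; then \<open>x\<close>
  is cancelled.\<close>

lemma artin_rees_nonzerodivisor:
  assumes A: "ideal A R" and x: "nonzerodivisor R x"
  obtains c where "\<And>n r. r \<in> carrier R \<Longrightarrow> x \<otimes> r \<in> ideal_pow R A (c + n) \<Longrightarrow> r \<in> ideal_pow R A n"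
proof -
  have xc: "x \<in> carrier R"
    using x by (simp add: nonzerodivisor_def)
  define B where "B = (\<lambda>v. x \<otimes> v) ` carrier R"
  have B: "ideal B R"
    unfolding B_def by (intro ideal_image_mult oneideal xc)
  note M = ideal_pow_ideal[OF A]
  have "graded_submodule R (ideal_pow R A) A (\<lambda>n. B \<inter> ideal_pow R A n)"
    unfolding graded_submodule_def
  proof (intro allI conjI ballI)
    fix n a u assume a: "a \<in> A" and u: "u \<in> B \<inter> ideal_pow R A n"
    then have "u \<otimes> a \<in> ideal_pow R A (Suc n)"
      unfolding ideal_pow_Suc by (auto intro: ideal_prod.prod)
    moreover have "a \<in> carrier R" "u \<in> carrier R"
      using a u ideal_mem(1)[OF A] ideal_mem(1)[OF B] by auto
    ultimately show "a \<otimes> u \<in> B \<inter> ideal_pow R A (Suc n)"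
      using u ideal_mem(5)[OF B] by (auto simp: m_comm)
  qed (auto intro: i_intersect B M)
  from rees_submodule_stable[OF A this] obtain c
    where c: "\<And>j. B \<inter> ideal_pow R A (c + j) \<subseteq> ideal_pow R A j \<cdot> (B \<inter> ideal_pow R A c)"
    by metis
  have "r \<in> ideal_pow R A n" if r: "r \<in> carrier R" "x \<otimes> r \<in> ideal_pow R A (c + n)" for n r
  proof -
    have "x \<otimes> r \<in> ideal_pow R A n \<cdot> (B \<inter> ideal_pow R A c)"
      using c[of n] r by (auto simp: B_def)
    also have "\<dots> \<subseteq> (\<lambda>v. x \<otimes> v) ` ideal_pow R A n"
    proof (rule ideal_prod_subsetI[OF ideal_image_mult[OF M xc]])
      fix i j assume i: "i \<in> ideal_pow R A n" and "j \<in> B \<inter> ideal_pow R A c"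
      then obtain v where v: "j = x \<otimes> v" "v \<in> carrier R"
        by (auto simp: B_def)
      have "i \<otimes> j = x \<otimes> (i \<otimes> v)"
        using ideal.Icarr[OF M i] v xc by (simp add: m_lcomm)
      then show "i \<otimes> j \<in> (\<lambda>v. x \<otimes> v) ` ideal_pow R A n"
        using ideal_mem(6)[OF M i v(2)] by blast
    qed
    finally obtain v where "v \<in> ideal_pow R A n" "x \<otimes> r = x \<otimes> v"
      by auto
    then show ?thesis
      using nonzerodivisor_cancel[OF x r(1), of v] ideal_mem(1)[OF M] by auto
  qed
  with that show thesis .
qed

section \<open>General elements acting on quotients of the Rees algebra\<close>

lemma wf_rees_submodules:
  assumes "ideal A R"
  shows "wf {(N', N). graded_submodule R (ideal_pow R A) A N \<and>
    graded_submodule R (ideal_pow R A) A N' \<and> N < N'}"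
  \<comment> \<open>The relation reverses inclusion: its descending chains are ascending chains of
    submodules, and induction hypotheses concern strictly larger submodules.\<close>
  unfolding wf_iff_no_infinite_down_chain
proof
  assume "\<exists>f. \<forall>i. (f (Suc i), f i) \<in> {(N', N). graded_submodule R (ideal_pow R A) A N \<and>
    graded_submodule R (ideal_pow R A) A N' \<and> N < N'}"
  then obtain f where f: "\<And>i. graded_submodule R (ideal_pow R A) A (f i)" "\<And>i. f i < f (Suc i)"
    by auto
  have "mono f"
    using f(2) by (intro iffD2[OF mono_iff_le_Suc]) (auto intro: less_imp_le)
  then obtain K where "\<And>k. k \<ge> K \<Longrightarrow> f k = f K"
    by (rule graded_noetherianD[OF rees_noetherian[OF assms]]) (use f in auto)
  from this[of "Suc K"] f(2)[of K] show False
    by simp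
qed

text \<open>For \<open>u\<close> in \<open>A^k\<close> this is the homogeneous annihilator of
  \<open>u t^k\<close> modulo \<open>N\<close>. With \<open>u = x\<close> and \<open>k = 1\<close>
  it becomes the kernel of multiplication by \<open>x t\<close> modulo \<open>N\<close>.\<close>

lemma rees_annihilator_submodule:
  assumes A: "ideal A R" and N: "graded_submodule R (ideal_pow R A) A N" and u: "u \<in> carrier R"
  shows "graded_submodule R (ideal_pow R A) A (\<lambda>j. {r \<in> ideal_pow R A j. r \<otimes> u \<in> N (k + j)})"
  unfolding graded_submodule_def
proof (intro allI conjI ballI)
  note N' = graded_submoduleD(1)[OF N] and M = ideal_pow_ideal[OF A]
  fix n
  have "{r \<in> ideal_pow R A n. r \<otimes> u \<in> N (k + n)}
      = ideal_pow R A n \<inter> {r \<in> carrier R. r \<otimes> u \<in> N (k + n)}"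
    using ideal_mem(1)[OF M] by blast
  then show "ideal {r \<in> ideal_pow R A n. r \<otimes> u \<in> N (k + n)} R"
    using i_intersect[OF M ideal_multiplier[OF N' u]] by simp
  fix a r assume a: "a \<in> A" and "r \<in> {r \<in> ideal_pow R A n. r \<otimes> u \<in> N (k + n)}"
  then have r: "r \<in> ideal_pow R A n" "r \<otimes> u \<in> N (k + n)"
    by auto
  have c: "a \<in> carrier R" "r \<in> carrier R"
    using a r ideal_mem(1)[OF A] ideal_mem(1)[OF M] by auto
  have "r \<otimes> a \<in> ideal_pow R A (Suc n)"
    unfolding ideal_pow_Suc using a r by (intro ideal_prod.prod)
  moreover have "(r \<otimes> a) \<otimes> u \<in> N (k + Suc n)"
    using graded_submoduleD(3)[OF N a r(2)] c u by (simp add: m_ac)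
  ultimately show "a \<otimes> r \<in> {r \<in> ideal_pow R A (Suc n). r \<otimes> u \<in> N (k + Suc n)}"
    using m_comm[OF c] by simp
qed auto

text \<open>The submodule generated by \<open>N\<close> and \<open>u t^k\<close>. Degrees below
  \<open>k\<close> are split off because truncated subtraction would add \<open>u R\<close>
  there.\<close>

lemma rees_adjoin_element:
  assumes A: "ideal A R" and N: "graded_submodule R (ideal_pow R A) A N"
    and u: "u \<in> ideal_pow R A k"
  shows "graded_submodule R (ideal_pow R A) A
    (\<lambda>n. if n < k then N n else N n <+>\<^bsub>R\<^esub> (\<lambda>v. u \<otimes> v) ` ideal_pow R A (n - k))"
    (is "graded_submodule R _ A ?N")
  unfolding graded_submodule_def
proof (intro allI conjI ballI)
  note N' = graded_submoduleD(1)[OF N] and M = ideal_pow_ideal[OF A]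
  have uc: "u \<in> carrier R"
    using u ideal_mem(1)[OF M] by auto
  fix n
  show "ideal (?N n) R"
    by (auto intro!: add_ideals ideal_image_mult N' M uc)
  show "?N n \<subseteq> ideal_pow R A n"
  proof (cases "n < k")
    case False
    then have "u \<otimes> v \<in> ideal_pow R A n" if "v \<in> ideal_pow R A (n - k)" for v
      using ideal_pow_mult_mem[OF A u that] by simp
    then show ?thesis
      using False graded_submoduleD(2)[OF N, of n] ideal_mem(3)[OF M]
      by (auto elim!: set_add_memE)
  qed (use graded_submoduleD(2)[OF N] in auto)
  fix a y assume a: "a \<in> A" and y: "y \<in> ?N n"
  have ac: "a \<in> carrier R"
    using a ideal_mem(1)[OF A] by auto
  show "a \<otimes> y \<in> ?N (Suc n)"
  proof (cases "n < k")
    case True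
    then have ay: "a \<otimes> y \<in> N (Suc n)"
      using a y graded_submoduleD(3)[OF N] by simp
    show ?thesis
    proof (cases "Suc n < k")
      case False
      have "a \<otimes> y \<oplus> u \<otimes> \<zero> \<in> ?N (Suc n)"
        using False ay ideal_mem(2)[OF M] by (auto intro!: set_add_memI)
      then show ?thesis
        using ay uc ideal_mem(1)[OF N'] by (simp add: subset_iff)
    qed (use ay in simp)
  next
    case False
    then obtain w v where wv: "w \<in> N n" "v \<in> ideal_pow R A (n - k)" "y = w \<oplus> u \<otimes> v"
      using y by (auto elim!: set_add_memE)
    then have c: "w \<in> carrier R" "v \<in> carrier R"
      using ideal_mem(1)[OF N'] ideal_mem(1)[OF M] by auto
    have "v \<otimes> a \<in> ideal_pow R A (Suc (n - k))"
      unfolding ideal_pow_Suc using a wv by (intro ideal_prod.prod)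
    then have "a \<otimes> w \<oplus> u \<otimes> (v \<otimes> a) \<in> ?N (Suc n)"
      using False graded_submoduleD(3)[OF N a wv(1)]
      by (auto intro!: set_add_memI simp: Suc_diff_le)
    also have "a \<otimes> w \<oplus> u \<otimes> (v \<otimes> a) = a \<otimes> y"
      unfolding wv(3) using c ac uc by algebra
    finally show ?thesis .
  qed
qed

text \<open>Noetherian induction. If \<open>u\<close> is a homogeneous element whose annihilator modulo \<open>N\<close> is
  maximal, this annihilator \<open>P\<close> is prime. An element \<open>x\<close> of \<open>A\<close> outside the degree-one part of \<open>P\<close>
  is injective on the submodule generated by \<open>u\<close> modulo \<open>N\<close>; if that degree-one part is all
  of \<open>A\<close>, then \<open>A\<close> kills \<open>u\<close>, and nothing has to be avoided.\<close>

lemma general_element_kernel_nilpotent: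
  assumes A: "ideal A R" and N: "graded_submodule R (ideal_pow R A) A N"
  shows "\<exists>\<B>. finite \<B> \<and> (\<forall>B\<in>\<B>. ideal B R \<and> \<not> A \<subseteq> B) \<and>
    (\<forall>x\<in>A - \<Union>\<B>. \<forall>n. \<forall>v\<in>ideal_pow R A n. x \<otimes> v \<in> N (Suc n) \<longrightarrow>
      (\<exists>b. \<forall>s\<in>ideal_pow R A b. s \<otimes> v \<in> N (n + b)))"
  using N
proof (induction N rule: wf_induct_rule[OF wf_rees_submodules[OF A]])
  case (1 N)
  note N = 1(2)
  note N' = graded_submoduleD(1)[OF N] and M = ideal_pow_ideal[OF A]
  show ?case
  proof (cases "\<forall>n. ideal_pow R A n \<subseteq> N n")
    case True
    have "s \<otimes> v \<in> N (n + b)" if "v \<in> ideal_pow R A n" "s \<in> ideal_pow R A b" for s v n b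
      using rees_submodule_pow_mult[OF A N] that True by blast
    then show ?thesis
      by (intro exI[of _ "{}"]) auto
  next
    case False
    define ann where "ann k u = (\<lambda>j. {r \<in> ideal_pow R A j. r \<otimes> u \<in> N (k + j)})" for k u
    define Q where "Q = {ann k u | k u. u \<in> ideal_pow R A k - N k}"
    have gs_ann: "graded_submodule R (ideal_pow R A) A (ann k u)" if "u \<in> ideal_pow R A k" for k u
      unfolding ann_def using that ideal_mem(1)[OF M] by (intro rees_annihilator_submodule A N) auto
    obtain z where "z \<in> Q"
      using False by (auto simp: Q_def)
    \<comment> \<open>\<open>Q\<close> collects the annihilators of homogeneous elements outside
      \<open>N\<close>; minimality for the reversed inclusion makes that of \<open>u\<close>
      maximal.\<close>
    from wfE_min[OF wf_rees_submodules[OF A] this] obtain k u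
      where u: "u \<in> ideal_pow R A k" "u \<notin> N k"
        and max: "\<And>l w. w \<in> ideal_pow R A l - N l \<Longrightarrow> \<not> ann k u < ann l w"
      using gs_ann by (auto simp: Q_def) (metis (no_types, lifting) DiffI)
    have uc: "u \<in> carrier R"
      using u ideal_mem(1)[OF M] by auto
    \<comment> \<open>If \<open>s u\<close> were outside \<open>N\<close>, its annihilator would
      contain that of \<open>u\<close> and so equal it by maximality; yet \<open>x\<close>, in
      degree one, annihilates \<open>s u\<close> but not \<open>u\<close>.\<close>
    have prime: "s \<otimes> u \<in> N (k + j)"
      if s: "s \<in> ideal_pow R A j" and x: "x \<in> A" "x \<otimes> (s \<otimes> u) \<in> N (Suc (k + j))"
        "x \<otimes> u \<notin> N (Suc k)" for s j x
    proof (rule ccontr)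
      assume "s \<otimes> u \<notin> N (k + j)"
      then have "s \<otimes> u \<in> ideal_pow R A (k + j) - N (k + j)"
        using ideal_pow_mult_mem[OF A s u(1)] by (simp add: add.commute)
      note not_less = max[OF this]
      have sc: "s \<in> carrier R"
        using s ideal_mem(1)[OF M] by auto
      have "ann k u \<le> ann (k + j) (s \<otimes> u)"
      proof (rule le_funI, rule subsetI)
        fix i r assume r: "r \<in> ann k u i"
        then have rc: "r \<in> ideal_pow R A i" "r \<otimes> u \<in> N (k + i)" "r \<in> carrier R"
          using ideal_mem(1)[OF M] by (auto simp: ann_def)
        have "s \<otimes> (r \<otimes> u) \<in> N (k + i + j)"
          using rees_submodule_pow_mult[OF A N rc(2) s] .
        then show "r \<in> ann (k + j) (s \<otimes> u) i"
          using rc sc uc by (simp add: ann_def m_lcomm add.commute add.left_commute)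
      qed
      then have "ann (k + j) (s \<otimes> u) \<le> ann k u"
        using not_less by (simp add: less_le_not_le)
      moreover have "x \<in> ann (k + j) (s \<otimes> u) (Suc 0)"
        using x unfolding ann_def ideal_pow_1[OF A] by simp
      ultimately have "x \<in> ann k u (Suc 0)"
        by (auto simp: le_fun_def)
      then show False
        using x(3) by (simp add: ann_def)
    qed
    \<comment> \<open>\<open>N\<^sub>1\<close> modulo \<open>N\<close> is generated by the class of
      \<open>u\<close>; being strictly larger than \<open>N\<close>, it falls under the induction
      hypothesis.\<close>
    define N\<^sub>1 where "N\<^sub>1 = (\<lambda>n. if n < k then N n
      else N n <+>\<^bsub>R\<^esub> (\<lambda>v. u \<otimes> v) ` ideal_pow R A (n - k))"
    have N\<^sub>1: "graded_submodule R (ideal_pow R A) A N\<^sub>1"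
      unfolding N\<^sub>1_def by (rule rees_adjoin_element[OF A N u(1)])
    have sub: "N n \<subseteq> N\<^sub>1 n" for n
    proof
      fix y assume y: "y \<in> N n"
      have "y \<oplus> u \<otimes> \<zero> \<in> N\<^sub>1 n" if "\<not> n < k"
        using that y ideal_mem(2)[OF M] by (auto simp: N\<^sub>1_def intro!: set_add_memI)
      then show "y \<in> N\<^sub>1 n"
        using y uc ideal_mem(1)[OF N'] by (cases "n < k") (auto simp: N\<^sub>1_def subset_iff)
    qed
    have "\<zero> \<oplus> u \<otimes> \<one> \<in> N\<^sub>1 k"
      using ideal_mem(2)[OF N'] unfolding N\<^sub>1_def diff_self_eq_0 ideal_pow_0
      by (auto intro!: set_add_memI)
    then have "u \<in> N\<^sub>1 k"
      using uc by simp
    with sub u(2) have "N < N\<^sub>1"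
      by (auto simp: less_le_not_le le_fun_def)
    then have "(N\<^sub>1, N) \<in> {(N', N). graded_submodule R (ideal_pow R A) A N \<and>
        graded_submodule R (ideal_pow R A) A N' \<and> N < N'}"
      using N N\<^sub>1 by simp
    from 1(1)[OF this N\<^sub>1] obtain \<B> where \<B>: "finite \<B>" "\<forall>B\<in>\<B>. ideal B R \<and> \<not> A \<subseteq> B"
      and ker: "\<forall>x\<in>A - \<Union>\<B>. \<forall>n. \<forall>v\<in>ideal_pow R A n. x \<otimes> v \<in> N\<^sub>1 (Suc n) \<longrightarrow>
        (\<exists>b. \<forall>s\<in>ideal_pow R A b. s \<otimes> v \<in> N\<^sub>1 (n + b))"
      by (elim exE conjE) (rule that)
    define P where "P = {r \<in> carrier R. r \<otimes> u \<in> N (Suc k)}"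
    have P: "ideal P R"
      unfolding P_def by (rule ideal_multiplier[OF N' uc])
    show ?thesis
    proof (cases "A \<subseteq> P")
      case True
      \<comment> \<open>Here \<open>A\<close> carries \<open>N\<^sub>1\<close> into
        \<open>N\<close>, so the exponent \<open>b\<close> from the induction hypothesis grows by
        one.\<close>
      have AN: "a \<otimes> y \<in> N (Suc n)" if a: "a \<in> A" and y: "y \<in> N\<^sub>1 n" for a y n
      proof (cases "n < k")
        case True
        then show ?thesis
          using a y graded_submoduleD(3)[OF N] by (simp add: N\<^sub>1_def)
      next
        case False
        then obtain w v where wv: "w \<in> N n" "v \<in> ideal_pow R A (n - k)" "y = w \<oplus> u \<otimes> v"
          using y by (auto simp: N\<^sub>1_def elim!: set_add_memE)
        then have c: "w \<in> carrier R" "v \<in> carrier R" "a \<in> carrier R"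
          using a ideal.Icarr[OF A] ideal.Icarr[OF N'] ideal.Icarr[OF M] by blast+
        have "v \<otimes> (a \<otimes> u) \<in> N (Suc k + (n - k))"
          using True a wv(2) by (intro rees_submodule_pow_mult[OF A N]) (auto simp: P_def)
        then have "a \<otimes> w \<oplus> v \<otimes> (a \<otimes> u) \<in> N (Suc n)"
          using False graded_submoduleD(3)[OF N a wv(1)] ideal_mem(3)[OF N'] by simp
        also have "a \<otimes> w \<oplus> v \<otimes> (a \<otimes> u) = a \<otimes> y"
          unfolding wv(3) using c uc by algebra
        finally show ?thesis .
      qed
      have "\<exists>b. \<forall>s\<in>ideal_pow R A b. s \<otimes> v \<in> N (n + b)"
        if x: "x \<in> A - \<Union>\<B>" and v: "v \<in> ideal_pow R A n" "x \<otimes> v \<in> N (Suc n)" for x n v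
      proof -
        obtain b where b: "\<And>s. s \<in> ideal_pow R A b \<Longrightarrow> s \<otimes> v \<in> N\<^sub>1 (n + b)"
          using ker[rule_format, OF x v(1) subsetD[OF sub v(2)]] by blast
        have vc: "v \<in> carrier R"
          using v(1) ideal_mem(1)[OF M] by auto
        have "ideal_pow R A (Suc b) \<subseteq> {s \<in> carrier R. s \<otimes> v \<in> N (Suc (n + b))}"
          unfolding ideal_pow_Suc
        proof (rule ideal_prod_subsetI[OF ideal_multiplier[OF N' vc]])
          fix s a assume s: "s \<in> ideal_pow R A b" and a: "a \<in> A"
          then have "s \<in> carrier R" "a \<in> carrier R"
            using ideal_mem(1)[OF M] ideal_mem(1)[OF A] by auto
          then show "s \<otimes> a \<in> {s \<in> carrier R. s \<otimes> v \<in> N (Suc (n + b))}"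
            using AN[OF a b[OF s]] vc by (simp add: m_ac)
        qed
        then have "\<forall>s\<in>ideal_pow R A (Suc b). s \<otimes> v \<in> N (n + Suc b)"
          unfolding add_Suc_right by blast
        then show ?thesis ..
      qed
      then show ?thesis
        using \<B> by (intro exI[of _ \<B>] conjI ballI allI impI) simp_all
    next
      case False
      have "\<exists>b. \<forall>s\<in>ideal_pow R A b. s \<otimes> v \<in> N (n + b)"
        if x: "x \<in> A - \<Union>(insert P \<B>)" and v: "v \<in> ideal_pow R A n" "x \<otimes> v \<in> N (Suc n)" for x n v
      proof -
        have "x \<in> A - \<Union>\<B>"
          using x by blast
        from ker[rule_format, OF this v(1) subsetD[OF sub v(2)]] obtain b
          where b: "\<And>s. s \<in> ideal_pow R A b \<Longrightarrow> s \<otimes> v \<in> N\<^sub>1 (n + b)"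
          by blast
        have xc: "x \<in> carrier R" "x \<otimes> u \<notin> N (Suc k)" "x \<in> A"
          using x ideal_mem(1)[OF A] by (auto simp: P_def)
        have "s \<otimes> v \<in> N (n + b)" if s: "s \<in> ideal_pow R A b" for s
        proof (cases "n + b < k")
          case True
          then show ?thesis
            using b[OF s] by (simp add: N\<^sub>1_def)
        next
          case False
          then obtain w t where wt: "w \<in> N (n + b)" "t \<in> ideal_pow R A (n + b - k)"
            "s \<otimes> v = w \<oplus> u \<otimes> t"
            using b[OF s] by (auto simp: N\<^sub>1_def elim!: set_add_memE)
          then have c: "w \<in> carrier R" "t \<in> carrier R" "s \<in> carrier R" "v \<in> carrier R"
            using s v ideal_mem(1)[OF N'] ideal_mem(1)[OF M] by auto
          \<comment> \<open>Both \<open>x s v\<close> and \<open>x w\<close> lie in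
            \<open>N\<close>, hence so does \<open>x t u\<close>, and primeness puts
            \<open>t u\<close> in \<open>N\<close>; the exponent \<open>b\<close> is kept.\<close>
          have "x \<otimes> (t \<otimes> u) = x \<otimes> (w \<oplus> u \<otimes> t) \<ominus> x \<otimes> w"
            using c xc uc by algebra
          also have "\<dots> = s \<otimes> (x \<otimes> v) \<ominus> x \<otimes> w"
            unfolding wt(3)[symmetric] using c xc by algebra
          also have "\<dots> \<in> N (Suc (n + b))"
            using rees_submodule_pow_mult[OF A N v(2) s] graded_submoduleD(3)[OF N xc(3) wt(1)]
            by (intro ideal_mem(4)[OF N']) simp_all
          finally have "t \<otimes> u \<in> N (n + b)"
            using prime[OF wt(2) xc(3) _ xc(2)] False by simp
          then show ?thesis
            using wt(1,3) ideal_mem(3)[OF N'] c uc by (simp add: m_comm)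
        qed
        then show ?thesis
          by blast
      qed
      then show ?thesis
        using \<B> False P by (intro exI[of _ "insert P \<B>"] conjI ballI allI impI) auto
    qed
  qed
qed

text \<open>The kernel of \<open>x t\<close> modulo \<open>N\<close> is generated in high degrees by
  its component in some degree \<open>n\<^sub>0\<close>. Each element there is killed by a power of
  \<open>A\<close> modulo \<open>N\<close>, and the chain condition makes the exponent uniform; so
  the kernel vanishes in large degrees.\<close>

lemma general_element_eventually_injective:
  assumes A: "ideal A R" and N: "graded_submodule R (ideal_pow R A) A N"
  shows "\<exists>\<B>. finite \<B> \<and> (\<forall>B\<in>\<B>. ideal B R \<and> \<not> A \<subseteq> B) \<and>
    (\<forall>x\<in>A - \<Union>\<B>.
      \<exists>n\<^sub>0. \<forall>n\<ge>n\<^sub>0. \<forall>v\<in>ideal_pow R A n. x \<otimes> v \<in> N (Suc n) \<longrightarrow> v \<in> N n)"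
proof -
  note N' = graded_submoduleD(1)[OF N] and M = ideal_pow_ideal[OF A]
  obtain \<B> where \<B>: "finite \<B>" "\<forall>B\<in>\<B>. ideal B R \<and> \<not> A \<subseteq> B"
    and ker: "\<forall>x\<in>A - \<Union>\<B>. \<forall>n. \<forall>v\<in>ideal_pow R A n. x \<otimes> v \<in> N (Suc n) \<longrightarrow>
      (\<exists>b. \<forall>s\<in>ideal_pow R A b. s \<otimes> v \<in> N (n + b))"
    using general_element_kernel_nilpotent[OF A N] by (elim exE conjE) (rule that)
  \<comment> \<open>\<open>T b\<close> consists of what the degree \<open>b\<close> part of the Rees
    algebra carries into \<open>N\<close>. These submodules increase with \<open>b\<close>, and the
    index \<open>K\<close> where they become constant is independent of \<open>x\<close>.\<close>
  define T where "T b n = {v \<in> ideal_pow R A n. \<forall>s\<in>ideal_pow R A b. s \<otimes> v \<in> N (n + b)}" for b n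
  have gsT: "graded_submodule R (ideal_pow R A) A (T b)" for b
    unfolding graded_submodule_def
  proof (intro allI conjI ballI)
    fix n
    show "T b n \<subseteq> ideal_pow R A n"
      by (auto simp: T_def)
    show "ideal (T b n) R"
    proof (rule cring_idealI)
      show "T b n \<subseteq> carrier R"
        using ideal_mem(1)[OF M] by (auto simp: T_def)
      show "\<zero> \<in> T b n"
        using ideal_mem(1)[OF M] ideal_mem(2)[OF M] ideal_mem(2)[OF N']
        by (auto simp: T_def subset_iff)
      show "x \<oplus> y \<in> T b n" if "x \<in> T b n" "y \<in> T b n" for x y
      proof -
        have "s \<otimes> (x \<oplus> y) \<in> N (n + b)" if s: "s \<in> ideal_pow R A b" for s
        proof -
          have "s \<otimes> x \<oplus> s \<otimes> y \<in> N (n + b)"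
            using \<open>x \<in> T b n\<close> \<open>y \<in> T b n\<close> s by (intro ideal_mem(3)[OF N']) (auto simp: T_def)
          moreover have "s \<in> carrier R" "x \<in> carrier R" "y \<in> carrier R"
            using \<open>x \<in> T b n\<close> \<open>y \<in> T b n\<close> s ideal_mem(1)[OF M] by (auto simp: T_def)
          ultimately show ?thesis
            by (simp add: r_distr)
        qed
        then show ?thesis
          using that ideal_mem(3)[OF M] by (auto simp: T_def)
      qed
      show "r \<otimes> x \<in> T b n" if x: "x \<in> T b n" and r: "r \<in> carrier R" for x r
      proof -
        have "s \<otimes> (r \<otimes> x) \<in> N (n + b)" if s: "s \<in> ideal_pow R A b" for s
        proof -
          have "r \<otimes> (s \<otimes> x) \<in> N (n + b)"
            using x s r by (intro ideal_mem(5)[OF N' _ r]) (auto simp: T_def)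
          moreover have "s \<in> carrier R" "x \<in> carrier R"
            using x s ideal.Icarr[OF M] by (auto simp: T_def)
          ultimately show ?thesis
            using r by (simp add: m_lcomm)
        qed
        then show ?thesis
          using x r ideal_mem(5)[OF M] by (auto simp: T_def)
      qed
    qed
    fix a v assume a: "a \<in> A" and v: "v \<in> T b n"
    have c: "a \<in> carrier R" "v \<in> carrier R"
      using a v ideal_mem(1)[OF A] ideal_mem(1)[OF M] by (auto simp: T_def)
    have "v \<otimes> a \<in> ideal_pow R A (Suc n)"
      unfolding ideal_pow_Suc using a v by (intro ideal_prod.prod) (auto simp: T_def)
    moreover have "s \<otimes> (a \<otimes> v) \<in> N (Suc n + b)" if s: "s \<in> ideal_pow R A b" for s
    proof -
      have "a \<otimes> (s \<otimes> v) \<in> N (Suc (n + b))"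
        using v s by (intro graded_submoduleD(3)[OF N a]) (auto simp: T_def)
      moreover have "s \<in> carrier R"
        using s ideal_mem(1)[OF M] by auto
      ultimately show ?thesis
        using c by (simp add: m_lcomm)
    qed
    ultimately show "a \<otimes> v \<in> T b (Suc n)"
      using c by (simp add: T_def m_comm)
  qed
  have "T b n \<subseteq> T (Suc b) n" for b n
  proof
    fix v assume v: "v \<in> T b n"
    have vc: "v \<in> carrier R"
      using v ideal_mem(1)[OF M] by (auto simp: T_def)
    have "ideal_pow R A (Suc b) \<subseteq> {s \<in> carrier R. s \<otimes> v \<in> N (n + Suc b)}"
      unfolding ideal_pow_Suc
    proof (rule ideal_prod_subsetI[OF ideal_multiplier[OF N' vc]])
      fix s a assume s: "s \<in> ideal_pow R A b" and a: "a \<in> A"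
      have "s \<in> carrier R" "a \<in> carrier R"
        using s a ideal_mem(1)[OF M] ideal_mem(1)[OF A] by auto
      moreover have "a \<otimes> (s \<otimes> v) \<in> N (Suc (n + b))"
        using v s by (intro graded_submoduleD(3)[OF N a]) (auto simp: T_def)
      ultimately show "s \<otimes> a \<in> {s \<in> carrier R. s \<otimes> v \<in> N (n + Suc b)}"
        using vc by (simp add: m_ac)
    qed
    then show "v \<in> T (Suc b) n"
      using v by (auto simp: T_def)
  qed
  then have monoT: "mono T"
    by (intro iffD2[OF mono_iff_le_Suc] allI le_funI)
  then obtain K where K: "\<And>k. k \<ge> K \<Longrightarrow> T k = T K"
    by (rule graded_noetherianD[OF rees_noetherian[OF A]]) (use gsT in auto)
  have TK: "T b n \<subseteq> T j n" if "j \<ge> K" for b j n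
    using le_funD[OF monoD[OF monoT, of b "max b K"], of n] K[of "max b K"] K[OF that] by simp
  have "\<exists>n\<^sub>0. \<forall>n\<ge>n\<^sub>0. \<forall>v\<in>ideal_pow R A n. x \<otimes> v \<in> N (Suc n) \<longrightarrow> v \<in> N n"
    if x: "x \<in> A - \<Union>\<B>" for x
  proof -
    have xc: "x \<in> carrier R"
      using x ideal_mem(1)[OF A] by auto
    define Z where "Z = (\<lambda>j. {r \<in> ideal_pow R A j. r \<otimes> x \<in> N (Suc 0 + j)})"
    have "graded_submodule R (ideal_pow R A) A Z"
      unfolding Z_def by (rule rees_annihilator_submodule[OF A N xc])
    from rees_submodule_stable[OF A this] obtain n\<^sub>0
      where n\<^sub>0: "\<And>j. Z (n\<^sub>0 + j) \<subseteq> ideal_pow R A j \<cdot> Z n\<^sub>0"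
      by metis
    have "v \<in> N n" if n: "n \<ge> n\<^sub>0 + K" and v: "v \<in> ideal_pow R A n" "x \<otimes> v \<in> N (Suc n)" for n v
    proof -
      define j where "j = n - n\<^sub>0"
      have j: "n = n\<^sub>0 + j" "j \<ge> K"
        using n by (auto simp: j_def)
      have "v \<in> Z n"
        using v xc ideal_mem(1)[OF M] by (auto simp: Z_def m_comm subset_iff)
      also have "Z n \<subseteq> ideal_pow R A j \<cdot> Z n\<^sub>0"
        unfolding j(1) by (rule n\<^sub>0)
      also have "\<dots> \<subseteq> N n"
      proof (rule ideal_prod_subsetI[OF N'])
        fix s y assume s: "s \<in> ideal_pow R A j" and "y \<in> Z n\<^sub>0"
        then have y: "y \<in> ideal_pow R A n\<^sub>0" "x \<otimes> y \<in> N (Suc n\<^sub>0)"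
          using xc ideal_mem(1)[OF M] by (auto simp: Z_def m_comm subset_iff)
        from ker[rule_format, OF x this] obtain b where "y \<in> T b n\<^sub>0"
          using y by (auto simp: T_def)
        then have "y \<in> T j n\<^sub>0"
          using TK[OF j(2)] by blast
        then show "s \<otimes> y \<in> N n"
          using s j by (auto simp: T_def)
      qed
      finally show ?thesis .
    qed
    then show ?thesis
      by blast
  qed
  then show ?thesis
    using \<B> by (intro exI[of _ \<B>] conjI ballI) simp_all
qed

end

section \<open>General elements of the maximal ideal\<close>

context noetherian_local_ring
begin

lemma maximal: "maximalideal \<mm> R"
  using unique_maximalideal by blast

lemma ideal_\<mm>: "ideal \<mm> R"
  using maximal by (rule maximalideal.axioms(1))

text \<open>By Zorn's lemma a non-unit lies in a maximal ideal, which must be \<mm>. Unions of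
  nonempty chains stay proper, since in a Noetherian ring they belong to the chain.\<close>

lemma unit_if_notin_maximal:
  assumes "x \<in> carrier R" "x \<notin> \<mm>"
  shows "x \<in> Units R"
proof (rule ccontr)
  assume "x \<notin> Units R"
  define \<J> where "\<J> = {J. ideal J R \<and> PIdl x \<subseteq> J \<and> J \<noteq> carrier R}"
  have "\<one> \<notin> PIdl x"
  proof
    assume "\<one> \<in> PIdl x"
    then obtain y where "y \<in> carrier R" "\<one> = y \<otimes> x"
      by (auto simp: cgenideal_def)
    then have "x \<in> Units R"
      using assms(1) by (auto simp: Units_def m_comm intro!: bexI[of _ y])
    with \<open>x \<notin> Units R\<close> show False ..
  qed
  then have "PIdl x \<in> \<J>"
    using cgenideal_ideal[OF assms(1)] by (auto simp: \<J>_def)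
  moreover have "\<Union>C \<in> \<J>" if "C \<noteq> {}" "subset.chain \<J> C" for C
  proof -
    have "subset.chain {J. ideal J R} C"
      using that(2) by (auto simp: pred_on.chain_def \<J>_def)
    then have "\<Union>C \<in> C"
      by (rule ideal_chain_is_trivial[OF that(1)])
    then show ?thesis
      using that(2) by (auto simp: pred_on.chain_def)
  qed
  ultimately obtain M where M: "M \<in> \<J>" "\<And>J. J \<in> \<J> \<Longrightarrow> M \<subseteq> J \<Longrightarrow> J = M"
    using subset_Zorn_nonempty[of \<J>] by blast
  have "maximalideal M R"
  proof (rule maximalidealI)
    show "ideal M R" "carrier R \<noteq> M"
      using M(1) by (auto simp: \<J>_def)
    show "J = M \<or> J = carrier R" if "ideal J R" "M \<subseteq> J" for J
      using M that by (auto simp: \<J>_def)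
  qed
  then have "M = \<mm>"
    using unique_maximalideal by blast
  moreover have "x \<in> M"
    using M(1) cgenideal_self[OF assms(1)] by (auto simp: \<J>_def)
  ultimately show False
    using assms(2) by simp
qed

text \<open>One representative is chosen per residue class; two of them differ by an element outside
  \<mm>, which is a unit.\<close>

lemma infinite_unit_differences:
  assumes "infinite (carrier (R Quot \<mm>))"
  shows "\<exists>T. infinite T \<and> T \<subseteq> carrier R \<and>
    (\<forall>c\<in>T. \<forall>d\<in>T. c \<noteq> d \<longrightarrow> c \<ominus> d \<in> Units R)"
proof -
  have "\<forall>C\<in>carrier (R Quot \<mm>). \<exists>c\<in>carrier R. C = \<mm> +> c"
    by (auto simp: FactRing_def A_RCOSETS_def')
  then obtain g where g: "\<And>C. C \<in> carrier (R Quot \<mm>) \<Longrightarrow> g C \<in> carrier R \<and> C = \<mm> +> g C"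
    by metis
  then have "inj_on g (carrier (R Quot \<mm>))"
    by (metis inj_onI)
  then have "infinite (g ` carrier (R Quot \<mm>))"
    using assms finite_imageD by blast
  moreover have "c \<ominus> d \<in> Units R"
    if cd: "c \<in> g ` carrier (R Quot \<mm>)" "d \<in> g ` carrier (R Quot \<mm>)" "c \<noteq> d" for c d
  proof (rule unit_if_notin_maximal)
    obtain C D where CD: "C \<in> carrier (R Quot \<mm>)" "D \<in> carrier (R Quot \<mm>)" "c = g C" "d = g D"
      using cd by auto
    then have c: "c \<in> carrier R" "d \<in> carrier R" "C = \<mm> +> c" "D = \<mm> +> d"
      using g by auto
    then show "c \<ominus> d \<in> carrier R"
      by simp
    have "C \<noteq> D"
      using CD cd(3) by auto
    then show "c \<ominus> d \<notin> \<mm>"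
      using quotient_eq_iff_same_a_r_cos[OF ideal_\<mm> c(1,2)] c(3,4) by simp
  qed
  moreover have "g ` carrier (R Quot \<mm>) \<subseteq> carrier R"
    using g by blast
  ultimately show ?thesis
    by (intro exI[of _ "g ` carrier (R Quot \<mm>)"] conjI ballI impI)
qed

text \<open>On a line \<open>x + c y\<close>, with the \<open>c\<close> pairwise incongruent modulo \<open>\<mm>\<close>, every ideal that does
  not contain both \<open>x\<close> and \<open>y\<close> has at most one point.\<close>

lemma linear_avoidance:
  assumes inf: "infinite (carrier (R Quot \<mm>))" and A: "ideal A R"
    and "finite \<B>" "\<And>B. B \<in> \<B> \<Longrightarrow> ideal B R \<and> \<not> A \<subseteq> B"
  shows "\<exists>x\<in>A. x \<notin> \<Union>\<B>"
  using assms(3,4)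
proof (induction \<B> rule: finite_induct)
  case empty
  then show ?case
    using ideal_mem(2)[OF A] by auto
next
  case (insert B \<B>)
  \<comment> \<open>\<open>x\<close> avoids the old ideals and \<open>y\<close> the new one, so no
    ideal of the family contains both.\<close>
  obtain x where x: "x \<in> A" "x \<notin> \<Union>\<B>"
    using insert by auto
  obtain y where y: "y \<in> A" "y \<notin> B"
    using insert.prems by blast
  have xy: "x \<in> carrier R" "y \<in> carrier R"
    using x y ideal_mem(1)[OF A] by auto
  obtain T where T: "infinite T" "T \<subseteq> carrier R"
    "\<forall>c\<in>T. \<forall>d\<in>T. c \<noteq> d \<longrightarrow> c \<ominus> d \<in> Units R"
    using infinite_unit_differences[OF inf] by (elim exE conjE) (rule that)
  show ?case
  proof (rule ccontr)
    assume *: "\<not> ?thesis"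
    have "\<exists>C\<in>insert B \<B>. x \<oplus> c \<otimes> y \<in> C" if "c \<in> T" for c
    proof -
      have "x \<oplus> c \<otimes> y \<in> A"
        using that T(2) x y by (intro ideal_mem(3,5)[OF A]) auto
      then show ?thesis
        using * by blast
    qed
    \<comment> \<open>Pigeonhole: some \<open>C\<close> contains two points of the line, hence
      \<open>y\<close>, hence also \<open>x\<close>.\<close>
    then have "T \<subseteq> (\<Union>C\<in>insert B \<B>. {c \<in> T. x \<oplus> c \<otimes> y \<in> C})"
      by blast
    then obtain C where C: "C \<in> insert B \<B>" "infinite {c \<in> T. x \<oplus> c \<otimes> y \<in> C}"
      using T(1) insert.hyps(1) finite_subset by (metis (no_types, lifting) finite.insertI finite_UN)
    obtain c where c: "c \<in> T" "x \<oplus> c \<otimes> y \<in> C"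
      using infinite_imp_nonempty[OF C(2)] by blast
    have "infinite ({c \<in> T. x \<oplus> c \<otimes> y \<in> C} - {c})"
      using C(2) by simp
    from infinite_imp_nonempty[OF this] obtain d where d: "d \<in> T" "x \<oplus> d \<otimes> y \<in> C" "c \<noteq> d"
      by blast
    have cd: "c \<in> carrier R" "d \<in> carrier R" and u: "c \<ominus> d \<in> Units R"
      using c d T by auto
    have I: "ideal C R"
      using C(1) insert.prems by blast
    have "(x \<oplus> c \<otimes> y) \<ominus> (x \<oplus> d \<otimes> y) \<in> C"
      using ideal_mem(4)[OF I c(2) d(2)] .
    also have "(x \<oplus> c \<otimes> y) \<ominus> (x \<oplus> d \<otimes> y) = (c \<ominus> d) \<otimes> y"
      using cd xy by algebra
    finally have "inv (c \<ominus> d) \<otimes> ((c \<ominus> d) \<otimes> y) \<in> C"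
      by (rule ideal_mem(5)[OF I]) (use u in simp)
    then have yC: "y \<in> C"
      using u xy cd by (simp add: m_assoc[symmetric])
    have "(x \<oplus> c \<otimes> y) \<ominus> c \<otimes> y \<in> C"
      using c(2) yC cd by (intro ideal_mem(4,5)[OF I])
    also have "(x \<oplus> c \<otimes> y) \<ominus> c \<otimes> y = x"
      using cd xy by algebra
    finally have "x \<in> C" .
    then show False
      using C(1) x y yC by blast
  qed
qed

text \<open>Otherwise all positive powers of \<mm> coincide, and Artin--Rees for a nonzerodivisor
  \<open>y\<close> in \<mm> turns \<open>y\<close> in \<open>\<mm>^(c + 1)\<close> into 1 in \<mm>.
  This does the work of Nakayama's lemma.\<close>

lemma maximal_not_subset_square:
  assumes "depth_positive R \<mm>"
  shows "\<not> \<mm> \<subseteq> ideal_pow R \<mm> 2"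
proof
  assume sub: "\<mm> \<subseteq> ideal_pow R \<mm> 2"
  obtain y where y: "y \<in> \<mm>" "nonzerodivisor R y"
    using assms by (auto simp: depth_positive_def)
  have "ideal_pow R \<mm> 2 = \<mm> \<cdot> \<mm>"
    by (simp only: numeral_2_eq_2 ideal_pow_Suc[of _ _ "Suc 0"] ideal_pow_1[OF ideal_\<mm>])
  then have sq: "\<mm> \<cdot> \<mm> = \<mm>"
    using sub ideal_prod_inter[OF ideal_\<mm> ideal_\<mm>] by blast
  have pow: "ideal_pow R \<mm> (Suc n) = \<mm>" for n
    by (induction n) (simp_all only: ideal_pow_1[OF ideal_\<mm>] ideal_pow_Suc[of _ _ "Suc _"] sq)
  obtain c where c: "\<And>n r. r \<in> carrier R \<Longrightarrow> y \<otimes> r \<in> ideal_pow R \<mm> (c + n) \<Longrightarrow>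
      r \<in> ideal_pow R \<mm> n"
    using artin_rees_nonzerodivisor[OF ideal_\<mm> y(2)] by meson
  have "y \<otimes> \<one> \<in> ideal_pow R \<mm> (c + Suc 0)"
    unfolding add_Suc_right pow using y ideal_mem(1)[OF ideal_\<mm>] by auto
  then have "\<one> \<in> \<mm>"
    using c[of \<one> "Suc 0"] unfolding pow by simp
  then show False
    using ideal.one_imp_carrier[OF ideal_\<mm>] maximalideal.I_notcarr[OF maximal] by simp
qed

text \<open>\<open>x\<close> is taken outside \<open>\<mm>^2\<close> and two finite families of
  ideals: avoiding the first makes it a nonzerodivisor, avoiding the second makes \<open>x t\<close>
  injective in large degrees modulo the submodule with components
  \<open>I \<mm>^(n + 1)\<close>.\<close>

lemma exists_superficial_element:
  assumes inf: "infinite (carrier (R Quot \<mm>))" and depth: "depth_positive R \<mm>"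
    and I: "ideal I R"
  obtains x k where "x \<in> \<mm> - ideal_pow R \<mm> 2"
    "\<And>n r. n \<ge> k \<Longrightarrow> r \<in> carrier R \<Longrightarrow> r \<otimes> x \<in> I \<cdot> ideal_pow R \<mm> (Suc n) \<Longrightarrow>
      r \<in> I \<cdot> ideal_pow R \<mm> n"
proof -
  note M = ideal_pow_ideal[OF ideal_\<mm>]
  define J where "J n = I \<cdot> ideal_pow R \<mm> n" for n
  have J: "ideal (J n) R" for n
    unfolding J_def by (intro ideal_prod_is_ideal I M)
  have JM: "J n \<subseteq> ideal_pow R \<mm> n" for n
    using ideal_prod_inter[OF I M] by (auto simp: J_def)
  have J_anti: "J n \<subseteq> J k" if "k \<le> n" for k n
    unfolding J_def using ideal_pow_anti_mono[OF ideal_\<mm> that] by (intro ideal_prod_mono order.refl)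
  have J_mult: "a \<otimes> u \<in> J (Suc n)" if "a \<in> \<mm>" "u \<in> J n" for a u n
  proof -
    have "u \<otimes> a \<in> J n \<cdot> \<mm>"
      using that by (intro ideal_prod.prod)
    also have "J n \<cdot> \<mm> = J (Suc n)"
      unfolding J_def ideal_pow_Suc by (rule ideal_prod_assoc[OF I M ideal_\<mm>])
    finally show ?thesis
      using that ideal.Icarr[OF ideal_\<mm>] ideal.Icarr[OF J] by (simp add: m_comm)
  qed
  have gs0: "graded_submodule R (ideal_pow R \<mm>) \<mm> (\<lambda>n. {\<zero>})"
    using ideal_mem(1)[OF ideal_\<mm>] ideal_mem(2)[OF M]
    by (auto simp: graded_submodule_def zeroideal)
  \<comment> \<open>The shift by one matters: for \<open>r\<close> in \<open>\<mm>^p\<close>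
    injectivity then yields \<open>r\<close> in \<open>J (Suc p)\<close>, a gain of one degree,
    whereas \<open>J p\<close> would give none.\<close>
  have gsJ: "graded_submodule R (ideal_pow R \<mm>) \<mm> (\<lambda>n. J (Suc n))"
    unfolding graded_submodule_def
  proof (intro allI conjI ballI J J_mult)
    show "J (Suc n) \<subseteq> ideal_pow R \<mm> n" for n
      using J_anti[of n "Suc n"] JM[of n] by simp
  qed
  obtain \<B>\<^sub>0 where B0: "finite \<B>\<^sub>0" "\<forall>B\<in>\<B>\<^sub>0. ideal B R \<and> \<not> \<mm> \<subseteq> B"
    "\<forall>x\<in>\<mm> - \<Union>\<B>\<^sub>0.
      \<exists>n\<^sub>0. \<forall>n\<ge>n\<^sub>0. \<forall>v\<in>ideal_pow R \<mm> n. x \<otimes> v \<in> {\<zero>} \<longrightarrow> v \<in> {\<zero>}"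
    using general_element_eventually_injective[OF ideal_\<mm> gs0] by (elim exE conjE) (rule that)
  obtain \<B>\<^sub>1 where B1: "finite \<B>\<^sub>1" "\<forall>B\<in>\<B>\<^sub>1. ideal B R \<and> \<not> \<mm> \<subseteq> B"
    "\<forall>x\<in>\<mm> - \<Union>\<B>\<^sub>1.
      \<exists>n\<^sub>0. \<forall>n\<ge>n\<^sub>0. \<forall>v\<in>ideal_pow R \<mm> n. x \<otimes> v \<in> J (Suc (Suc n)) \<longrightarrow> v \<in> J (Suc n)"
    using general_element_eventually_injective[OF ideal_\<mm> gsJ] by (elim exE conjE) (rule that)
  have "\<exists>x\<in>\<mm>. x \<notin> \<Union>(insert (ideal_pow R \<mm> 2) (\<B>\<^sub>0 \<union> \<B>\<^sub>1))"
    using B0(1,2) B1(1,2) M[of 2] maximal_not_subset_square[OF depth]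
    by (intro linear_avoidance[OF inf ideal_\<mm>]) auto
  then obtain x where x: "x \<in> \<mm>" "x \<notin> ideal_pow R \<mm> 2" "x \<in> \<mm> - \<Union>\<B>\<^sub>0" "x \<in> \<mm> - \<Union>\<B>\<^sub>1"
    by blast
  have xc: "x \<in> carrier R"
    using x ideal_mem(1)[OF ideal_\<mm>] by auto
  obtain n\<^sub>0 where n0: "\<And>v. v \<in> ideal_pow R \<mm> n\<^sub>0 \<Longrightarrow> x \<otimes> v = \<zero> \<Longrightarrow> v = \<zero>"
    using B0(3)[rule_format, OF x(3)] by (elim exE) (metis order.refl singletonD singletonI)
  obtain y where y: "y \<in> \<mm>" "nonzerodivisor R y"
    using depth by (auto simp: depth_positive_def)
  have yc: "y \<in> carrier R"
    using y ideal_mem(1)[OF ideal_\<mm>] by auto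
  have cancel_pow: "z = \<zero>" if "z \<in> carrier R" "y [^] n \<otimes> z = \<zero>" for z and n :: nat
    using that
  proof (induction n)
    case (Suc n)
    have "y \<otimes> (y [^] n \<otimes> z) = \<zero>"
      using Suc.prems yc by (simp add: m_ac)
    then have "y [^] n \<otimes> z = \<zero>"
      using y(2) yc Suc.prems(1) unfolding nonzerodivisor_def by blast
    with Suc.prems(1) show ?case
      by (rule Suc.IH)
  qed simp
  \<comment> \<open>Injectivity of \<open>x\<close> is known only in large degrees; multiplication
    by \<open>y [^] n\<^sub>0\<close> carries any \<open>z\<close> there and is itself
    injective.\<close>
  have nzd: "nonzerodivisor R x"
    unfolding nonzerodivisor_def
  proof (intro conjI ballI impI xc)
    fix z assume z: "z \<in> carrier R" "x \<otimes> z = \<zero>"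
    have "y [^] n\<^sub>0 \<otimes> z \<in> ideal_pow R \<mm> n\<^sub>0"
      using ideal_pow_mem_power[OF ideal_\<mm> y(1)] z(1) by (intro ideal_mem(6)[OF M])
    moreover have "x \<otimes> (y [^] n\<^sub>0 \<otimes> z) = y [^] n\<^sub>0 \<otimes> (x \<otimes> z)"
      using xc yc z(1) by (simp add: m_lcomm)
    then have "x \<otimes> (y [^] n\<^sub>0 \<otimes> z) = \<zero>"
      using z yc by simp
    ultimately show "z = \<zero>"
      using n0 cancel_pow z(1) by blast
  qed
  obtain c where c: "\<And>n r. r \<in> carrier R \<Longrightarrow> x \<otimes> r \<in> ideal_pow R \<mm> (c + n) \<Longrightarrow>
      r \<in> ideal_pow R \<mm> n"
    by (rule artin_rees_nonzerodivisor[OF ideal_\<mm> nzd]) meson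
  obtain n\<^sub>1 where n1: "\<And>n v. n \<ge> n\<^sub>1 \<Longrightarrow> v \<in> ideal_pow R \<mm> n \<Longrightarrow> x \<otimes> v \<in> J (Suc (Suc n)) \<Longrightarrow>
      v \<in> J (Suc n)"
    using B1(3)[rule_format, OF x(4)] by (elim exE) (metis that)
  \<comment> \<open>The bound keeps the starting exponent \<open>n - Suc c\<close> at least
    \<open>n\<^sub>1\<close>, and it stays below \<open>n\<close>.\<close>
  have "r \<in> J n" if n: "n \<ge> Suc (n\<^sub>1 + c)" and r: "r \<in> carrier R" "r \<otimes> x \<in> J (Suc n)" for n r
  proof -
    have rx: "x \<otimes> r \<in> J (Suc n)"
      using r xc by (simp add: m_comm)
    have one_step: "r \<in> J (Suc p)" if p: "n\<^sub>1 \<le> p" "p < n" "r \<in> ideal_pow R \<mm> p" for p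
    proof (rule n1[OF p(1,3)])
      show "x \<otimes> r \<in> J (Suc (Suc p))"
        using p(2) by (intro subsetD[OF J_anti rx]) simp
    qed
    have start: "r \<in> ideal_pow R \<mm> p" if p: "c + p \<le> Suc n" for p
      by (rule c[OF r(1)]) (rule subsetD[OF ideal_pow_anti_mono[OF ideal_\<mm> p] subsetD[OF JM rx]])
    have "r \<in> ideal_pow R \<mm> p" if "n - Suc c \<le> p" "p < n" for p
      using that
    proof (induction p rule: dec_induct)
      case base
      show ?case
        using n by (intro start) simp
    next
      case (step p)
      have "r \<in> ideal_pow R \<mm> p"
        using step.prems by (intro step.IH) simp
      then have "r \<in> J (Suc p)"
        using n step.hyps(1) step.prems by (intro one_step) simp_all
      then show ?case
        by (rule subsetD[OF JM])
    qed
    then have "r \<in> ideal_pow R \<mm> (n - 1)"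
      using n by simp
    \<comment> \<open>The last admissible step: it uses \<open>x r\<close> in
      \<open>J (Suc n)\<close> at full strength.\<close>
    then have "r \<in> J (Suc (n - 1))"
      using n by (intro one_step) simp_all
    then show ?thesis
      using n by simp
  qed
  then show thesis
    using x by (intro that[of x "Suc (n\<^sub>1 + c)"]) (auto simp: J_def)
qed

section \<open>Comparison of the three notions\<close>

text \<open>Since \<open>x\<close> lies in \<mm>, the ideal \<open>J\<close> is always contained in
  the colon ideal; the condition is the other inclusion.\<close>

lemma m_full_iff:
  assumes J: "ideal J R"
  shows "m_full R \<mm> J \<longleftrightarrow>
    (\<exists>x\<in>\<mm> - ideal_pow R \<mm> 2. \<forall>r\<in>carrier R. r \<otimes> x \<in> J \<cdot> \<mm> \<longrightarrow> r \<in> J)"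
proof -
  have "elem_colon R (J \<cdot> \<mm>) x = J \<longleftrightarrow> (\<forall>r\<in>carrier R. r \<otimes> x \<in> J \<cdot> \<mm> \<longrightarrow> r \<in> J)"
    if x: "x \<in> \<mm>" for x
  proof -
    have eq: "elem_colon R (J \<cdot> \<mm>) x = {r \<in> carrier R. r \<otimes> x \<in> J \<cdot> \<mm>}"
      by (rule elem_colon_eq[OF ideal_prod_is_ideal[OF J ideal_\<mm>] ideal.Icarr[OF ideal_\<mm> x]])
    have "J \<subseteq> {r \<in> carrier R. r \<otimes> x \<in> J \<cdot> \<mm>}"
    proof
      fix r assume "r \<in> J"
      then show "r \<in> {r \<in> carrier R. r \<otimes> x \<in> J \<cdot> \<mm>}"
        by (intro CollectI conjI ideal.Icarr[OF J] ideal_prod.prod x)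
    qed
    then show ?thesis
      unfolding eq by blast
  qed
  then show ?thesis
    unfolding m_full_def by (intro bex_cong refl) (simp only: Diff_iff)
qed

lemma weakly_m_full_iff:
  assumes J: "ideal J R"
  shows "weakly_m_full R \<mm> J \<longleftrightarrow>
    (\<forall>r\<in>carrier R. (\<forall>b\<in>\<mm>. r \<otimes> b \<in> J \<cdot> \<mm>) \<longrightarrow> r \<in> J)"
proof -
  have "J \<subseteq> {r \<in> carrier R. \<forall>b\<in>\<mm>. r \<otimes> b \<in> J \<cdot> \<mm>}"
  proof
    fix r assume "r \<in> J"
    then show "r \<in> {r \<in> carrier R. \<forall>b\<in>\<mm>. r \<otimes> b \<in> J \<cdot> \<mm>}"
      by (intro CollectI conjI ballI ideal.Icarr[OF J] ideal_prod.prod)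
  qed
  then show ?thesis
    unfolding weakly_m_full_def ideal_colon_def by blast
qed

lemma m_full_imp_weakly_m_full:
  assumes "ideal J R" "m_full R \<mm> J"
  shows "weakly_m_full R \<mm> J"
  using assms(2) unfolding m_full_iff[OF assms(1)] weakly_m_full_iff[OF assms(1)] by blast

text \<open>From \<open>r x\<close> in \<open>J\<close> follows \<open>(r b) x\<close> in
  \<open>J \<mm>\<close> for \<open>b\<close> in \<mm>, hence \<open>r b\<close> in \<open>J\<close>
  for the \<open>x\<close> that witnesses \<mm>-fullness.\<close>

lemma m_full_imp_full:
  assumes J: "ideal J R" and "m_full R \<mm> J"
  shows "full R \<mm> J"
proof -
  obtain x where x: "x \<in> \<mm> - ideal_pow R \<mm> 2"
    and xJ: "\<And>r. r \<in> carrier R \<Longrightarrow> r \<otimes> x \<in> J \<cdot> \<mm> \<Longrightarrow> r \<in> J"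
    using assms(2) unfolding m_full_iff[OF J] by blast
  have xc: "x \<in> carrier R"
    using x ideal.Icarr[OF ideal_\<mm>] by blast
  have "r \<otimes> b \<in> J" if r: "r \<in> carrier R" "r \<otimes> x \<in> J" and b: "b \<in> \<mm>" for r b
  proof (rule xJ)
    have bc: "b \<in> carrier R"
      using b ideal.Icarr[OF ideal_\<mm>] by blast
    then show "r \<otimes> b \<in> carrier R"
      using r by simp
    have "(r \<otimes> x) \<otimes> b \<in> J \<cdot> \<mm>"
      using r b by (intro ideal_prod.prod)
    also have "(r \<otimes> x) \<otimes> b = (r \<otimes> b) \<otimes> x"
      using r xc bc by (simp add: m_ac)
    finally show "(r \<otimes> b) \<otimes> x \<in> J \<cdot> \<mm>" .
  qed
  then have "elem_colon R J x = ideal_colon R J \<mm>"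
    unfolding elem_colon_eq[OF J xc] ideal_colon_def using x by blast
  then show ?thesis
    unfolding full_def using x by blast
qed

text \<open>If \<open>r x\<close> lies in \<open>J \<mm>\<close>, then \<open>(r b) x\<close> lies
  in \<open>J \<mm>^2\<close> for all \<open>b\<close> in \<mm>. The choice of \<open>x\<close> for
  \<open>J \<mm>\<close> gives \<open>r b\<close> in \<open>J \<mm>\<close>, and weak \<mm>-fullness
  gives \<open>r\<close> in \<open>J\<close>.\<close>

lemma weakly_m_full_descent:
  assumes J: "ideal J R" and "weakly_m_full R \<mm> J" "m_full R \<mm> (J \<cdot> \<mm>)"
  shows "m_full R \<mm> J"
proof -
  obtain x where x: "x \<in> \<mm> - ideal_pow R \<mm> 2"
    and xJ: "\<And>r. r \<in> carrier R \<Longrightarrow> r \<otimes> x \<in> J \<cdot> \<mm> \<cdot> \<mm> \<Longrightarrow> r \<in> J \<cdot> \<mm>"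
    using assms(3) unfolding m_full_iff[OF ideal_prod_is_ideal[OF J ideal_\<mm>]] by blast
  have xc: "x \<in> carrier R"
    using x ideal.Icarr[OF ideal_\<mm>] by blast
  have "r \<otimes> b \<in> J \<cdot> \<mm>" if r: "r \<in> carrier R" "r \<otimes> x \<in> J \<cdot> \<mm>" and b: "b \<in> \<mm>" for r b
  proof (rule xJ)
    have bc: "b \<in> carrier R"
      using b ideal.Icarr[OF ideal_\<mm>] by blast
    then show "r \<otimes> b \<in> carrier R"
      using r by simp
    have "(r \<otimes> x) \<otimes> b \<in> J \<cdot> \<mm> \<cdot> \<mm>"
      by (rule ideal_prod.prod[OF r(2) b])
    also have "(r \<otimes> x) \<otimes> b = (r \<otimes> b) \<otimes> x"
      using r xc bc by (simp add: m_ac)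
    finally show "(r \<otimes> b) \<otimes> x \<in> J \<cdot> \<mm> \<cdot> \<mm>" .
  qed
  then show ?thesis
    using assms(2) x unfolding m_full_iff[OF J] weakly_m_full_iff[OF J] by blast
qed

lemma eventually_m_full:
  assumes "infinite (carrier (R Quot \<mm>))" "depth_positive R \<mm>" and I: "ideal I R"
  shows "\<exists>k. \<forall>n\<ge>k. m_full R \<mm> (I \<cdot> ideal_pow R \<mm> n)"
proof -
  note M = ideal_pow_ideal[OF ideal_\<mm>]
  obtain x k where x: "x \<in> \<mm> - ideal_pow R \<mm> 2"
    "\<And>n r. n \<ge> k \<Longrightarrow> r \<in> carrier R \<Longrightarrow> r \<otimes> x \<in> I \<cdot> ideal_pow R \<mm> (Suc n) \<Longrightarrow>
      r \<in> I \<cdot> ideal_pow R \<mm> n"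
    by (rule exists_superficial_element[OF assms]) meson
  then have "m_full R \<mm> (I \<cdot> ideal_pow R \<mm> n)" if "n \<ge> k" for n
    unfolding m_full_iff[OF ideal_prod_is_ideal[OF I M]]
      ideal_prod_assoc[OF I M ideal_\<mm>] ideal_pow_Suc[symmetric]
    using that by blast
  then show ?thesis
    by blast
qed

end

theorem proposition2p2:
  fixes R :: "('a, 'b) ring_scheme" and \<mm> I :: "'a set"
  assumes "noetherian_local_ring R \<mm>"
    and "infinite (carrier (R Quot \<mm>))"
    and "depth_positive R \<mm>"
    and "ideal I R"
  shows "n\<^sub>2 R \<mm> I \<le> n\<^sub>3 R \<mm> I \<and> n\<^sub>3 R \<mm> I = n\<^sub>1 R \<mm> I"
proof -
  interpret noetherian_local_ring R \<mm>
    by fact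
  define J where "J n = I \<cdot>\<^bsub>R\<^esub> ideal_pow R \<mm> n" for n
  have J: "ideal (J n) R" for n
    unfolding J_def by (intro ideal_prod_is_ideal assms ideal_pow_ideal ideal_\<mm>)
  have J_Suc: "J (Suc n) = J n \<cdot>\<^bsub>R\<^esub> \<mm>" for n
    unfolding J_def ideal_pow_Suc
    by (rule ideal_prod_assoc[OF assms(4) ideal_pow_ideal[OF ideal_\<mm>] ideal_\<mm>, symmetric])
  obtain k where k: "\<And>n. n \<ge> k \<Longrightarrow> m_full R \<mm> (J n)"
    using eventually_m_full[OF assms(2-4)] by (auto simp: J_def)
  have "m_full R \<mm> (J n)" if t: "\<forall>n\<ge>t. weakly_m_full R \<mm> (J n)" and n: "n \<ge> t" for t n
  proof (cases "n \<le> k")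
    case True
    then show ?thesis
    \<comment> \<open>Descent from \<open>k\<close> to \<open>n\<close>; every index on the way is
      at least \<open>t\<close>, where weak \<mm>-fullness is available.\<close>
    proof (induction rule: inc_induct)
      case (step i)
      then show ?case
        using t n weakly_m_full_descent[OF J] by (simp add: J_Suc)
    qed (simp add: k)
  qed (simp add: k)
  \<comment> \<open>The two tail conditions agree for each \<open>t\<close>, so both minima are
    taken over the same set.\<close>
  then have iff: "(\<forall>n\<ge>t. weakly_m_full R \<mm> (J n)) \<longleftrightarrow> (\<forall>n\<ge>t. m_full R \<mm> (J n))" for t
    using m_full_imp_weakly_m_full[OF J] by blast
  have 31: "n\<^sub>3 R \<mm> I = n\<^sub>1 R \<mm> I"
    unfolding n\<^sub>3_def n\<^sub>1_def J_def[symmetric] iff ..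
  \<comment> \<open>The bound \<open>k\<close> shows that the set is nonempty, so
    \<open>LEAST\<close> has its defining property.\<close>
  have "\<forall>n\<ge>n\<^sub>1 R \<mm> I. m_full R \<mm> (J n)"
    unfolding n\<^sub>1_def J_def[symmetric] by (rule LeastI[of _ k]) (use k in blast)
  then have "n\<^sub>2 R \<mm> I \<le> n\<^sub>1 R \<mm> I"
    unfolding n\<^sub>2_def J_def[symmetric] using m_full_imp_full[OF J] by (intro Least_le) blast
  with 31 show ?thesis
    by simp
qed

end
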